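(* Let $d\ge1$, let $U:\mathbb{R}^d\to\mathbb{R}$ be a measurable external potential and $W\in L^\infty(\mathbb{R}^d)$ a symmetric ($W(-x)=W(x)$) interaction kernel. For each $\alpha>d/2$ there exists a constant $C$ depending only on $\alpha$ (with $d$ fixed) such that, for all $\beta>0$ small enough (with $\exp(-\beta E_N)\in L^1(\mathbb{R}^{Nd})$ for all $N\ge2$) and all $N$ large enough, $$\mathbb{E}\,\|\mu_N-\rho\|_{H^{-\alpha}}^2\le\frac{C}{N},$$ where $\rho$ is a minimizer of the mean-field free energy $\mathcal{F}$ over probability densities on $\mathbb{R}^d$ and $\mu_N=\frac1N\sum_{i=1}^N\delta_{X_i}$ is the empirical measure of $(X_1,\dots,X_N)\sim\rho_N$, with $\rho_N$ the $N$-body Gibbs measure (see context).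
   Context: For $N\ge2$ and $x_1,\dots,x_N\in\mathbb{R}^d$, the energy is $$E_N(x_1,\dots,x_N)=\sum_{i=1}^N U(x_i)+\frac{1}{2(N-1)}\sum_{i\ne j}W(x_i-x_j).$$ The $N$-body Gibbs measure is the probability measure on $\mathbb{R}^{Nd}$ with density $\rho_N=\bar Z_N^{-1}\exp(-\beta E_N)$, $\bar Z_N$ the normalizing constant. The mean-field free energy of a probability density $\rho$ on $\mathbb{R}^d$ is $$\mathcal{F}(\rho)=\int_{\mathbb{R}^d}U\rho\,dx+\frac12\int_{\mathbb{R}^d}\rho\,(W*\rho)\,dx+\beta^{-1}\int_{\mathbb{R}^d}\rho\log\rho\,dx,$$ where $(W*\rho)(x)=\int W(x-y)\rho(y)\,dy$; the sum $\int (U\rho+\beta^{-1}\rho\log\rho)\,dx$ is understood as a single integral, with values in $(-\infty,+\infty]$. For a finite signed measure $f$ on $\mathbb{R}^d$, $\|f\|_{H^{-\alpha}}^2=\int_{\mathbb{R}^d}(1+|\xi|^2)^{-\alpha}|\hat f(\xi)|^2\,d\xi$ with $\hat f(\xi)=\int e^{i\xi\cdot x}f(dx)$. "$\beta$ small enough" means $\beta<\beta_0$ for some $\beta_0>0$ that may depend on the data $\alpha,d,U,W$; "$N$ large enough" means $N>N_0$, where $N_0$ may depend on all the data including $\beta$. *)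

theory Defs
  imports "HOL-Analysis.Analysis"
begin

text \<open>
  The space \<open>\<real>\<^sup>d\<close> is a Euclidean space \<open>'a\<close> with \<open>d = DIM('a)\<close>, so \<open>d \<ge> 1\<close> is automatic.
  Measurable means Lebesgue measurable throughout. A configuration \<open>(x\<^sub>1, \<dots>, x\<^sub>N)\<close> is a
  function on the index set \<open>{1..N}\<close>; Lebesgue measure on \<open>\<real>\<^bsup>Nd\<^esup>\<close> is the completion of
  the \<open>N\<close>-fold product of Borel--Lebesgue measure, because \<open>(x\<^sub>1, \<dots>, x\<^sub>N) \<mapsto> W (x\<^sub>i - x\<^sub>j)\<close> need not
  be measurable for the product of the Lebesgue sigma-algebras.
\<close>

definition lebesgue_conf :: "nat \<Rightarrow> (nat \<Rightarrow> 'a::euclidean_space) measure" where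
  "lebesgue_conf N = completion (\<Pi>\<^sub>M i\<in>{1..N}. lborel)"

definition L_infty :: "('a::euclidean_space \<Rightarrow> real) set" where
  "L_infty = {W \<in> borel_measurable lebesgue. \<exists>B. AE x in lebesgue. \<bar>W x\<bar> \<le> B}"

definition energy :: "('a::euclidean_space \<Rightarrow> real) \<Rightarrow> ('a \<Rightarrow> real) \<Rightarrow> nat \<Rightarrow> (nat \<Rightarrow> 'a) \<Rightarrow> real" where
  "energy U W N x =
     (\<Sum>i=1..N. U (x i)) + 1 / (2 * (real N - 1)) * (\<Sum>i=1..N. \<Sum>j\<in>{1..N} - {i}. W (x i - x j))"

definition partition_fun :: "real \<Rightarrow> ('a::euclidean_space \<Rightarrow> real) \<Rightarrow> ('a \<Rightarrow> real) \<Rightarrow> nat \<Rightarrow> real" where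
  "partition_fun \<beta> U W N = (LINT x|lebesgue_conf N. exp (- \<beta> * energy U W N x))"

definition gibbs ::
  "real \<Rightarrow> ('a::euclidean_space \<Rightarrow> real) \<Rightarrow> ('a \<Rightarrow> real) \<Rightarrow> nat \<Rightarrow> (nat \<Rightarrow> 'a) measure" where
  "gibbs \<beta> U W N =
     density (lebesgue_conf N) (\<lambda>x. ennreal (exp (- \<beta> * energy U W N x) / partition_fun \<beta> U W N))"

definition prob_densities :: "('a::euclidean_space \<Rightarrow> real) set" where
  "prob_densities =
     {\<rho> \<in> borel_measurable lebesgue. (\<forall>x. 0 \<le> \<rho> x) \<and> (\<integral>\<^sup>+x. ennreal (\<rho> x) \<partial>lebesgue) = 1}"

text \<open>
  Integral of a real function with values in the extended reals, as the difference of the integrals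
  of the positive and the negative part. In the free energy the negative part is integrable
  whenever \<open>exp (- \<beta> U)\<close> is, since \<open>\<beta> U \<rho> + \<rho> ln \<rho> \<ge> \<rho> - exp (- \<beta> U)\<close>.
\<close>

definition ext_integral :: "'b measure \<Rightarrow> ('b \<Rightarrow> real) \<Rightarrow> ereal" where
  "ext_integral M g =
     enn2ereal (\<integral>\<^sup>+x. ennreal (g x) \<partial>M) - enn2ereal (\<integral>\<^sup>+x. ennreal (- g x) \<partial>M)"

definition convol :: "('a::euclidean_space \<Rightarrow> real) \<Rightarrow> ('a \<Rightarrow> real) \<Rightarrow> 'a \<Rightarrow> real" where
  "convol W \<rho> x = (LINT y|lebesgue. W (x - y) * \<rho> y)"

text \<open>\<open>\<rho> x * ln (\<rho> x)\<close> is \<open>0\<close> where \<open>\<rho> x = 0\<close>, as usual.\<close>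

definition free_energy ::
  "real \<Rightarrow> ('a::euclidean_space \<Rightarrow> real) \<Rightarrow> ('a \<Rightarrow> real) \<Rightarrow> ('a \<Rightarrow> real) \<Rightarrow> ereal" where
  "free_energy \<beta> U W \<rho> =
     ext_integral lebesgue (\<lambda>x. U x * \<rho> x + 1 / \<beta> * (\<rho> x * ln (\<rho> x)))
       + ereal (1 / 2 * (LINT x|lebesgue. \<rho> x * convol W \<rho> x))"

definition is_minimizer ::
  "real \<Rightarrow> ('a::euclidean_space \<Rightarrow> real) \<Rightarrow> ('a \<Rightarrow> real) \<Rightarrow> ('a \<Rightarrow> real) \<Rightarrow> bool" where
  "is_minimizer \<beta> U W \<rho> \<longleftrightarrow>
     \<rho> \<in> prob_densities \<and> (\<forall>\<sigma>\<in>prob_densities. free_energy \<beta> U W \<rho> \<le> free_energy \<beta> U W \<sigma>)"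

text \<open>
  \<open>1/N * (\<delta>\<^bsub>x 1\<^esub> + \<dots> + \<delta>\<^bsub>x N\<^esub>)\<close>, with multiplicities, as the image under \<open>x\<close> of the uniform
  distribution on the indices.
\<close>

definition empirical :: "nat \<Rightarrow> (nat \<Rightarrow> 'a::euclidean_space) \<Rightarrow> 'a measure" where
  "empirical N x = distr (uniform_count_measure {1..N}) lebesgue x"

lemma emeasure_empirical:
  assumes "A \<in> sets lebesgue" and "N \<ge> 1"
  shows "emeasure (empirical N x) A = ennreal (1 / real N * (\<Sum>i=1..N. indicator A (x i)))"
proof -
  have "emeasure (empirical N x) A = emeasure (uniform_count_measure {1..N}) (x -` A \<inter> {1..N})"
    unfolding empirical_def
    using assms
    by (subst emeasure_distr)
      (auto simp: measurable_def space_uniform_count_measure sets_uniform_count_measure)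
  also have "\<dots> = ennreal (real (card (x -` A \<inter> {1..N})) / real N)"
    using assms by (subst emeasure_uniform_count_measure) auto
  also have "real (card (x -` A \<inter> {1..N})) = (\<Sum>i=1..N. indicator A (x i))"
    by (simp add: indicator_def sum.If_cases Int_def conj_commute)
  finally show ?thesis by simp
qed

definition fourier :: "'a::euclidean_space measure \<Rightarrow> 'a \<Rightarrow> complex" where
  "fourier M \<xi> = (LINT x|M. cis (\<xi> \<bullet> x))"

text \<open>
  The squared \<open>H\<^bsup>-\<alpha>\<^esup>\<close> norm of the signed measure \<open>\<mu> - \<nu>\<close>, for finite measures \<open>\<mu>\<close> and \<open>\<nu>\<close>
  (not necessarily mutually singular).
\<close>

definition Hneg_norm2_diff ::
  "real \<Rightarrow> 'a::euclidean_space measure \<Rightarrow> 'a measure \<Rightarrow> ennreal" where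
  "Hneg_norm2_diff \<alpha> \<mu> \<nu> =
     (\<integral>\<^sup>+\<xi>. ennreal ((1 + (norm \<xi>)\<^sup>2) powr (- \<alpha>) * (cmod (fourier \<mu> \<xi> - fourier \<nu> \<xi>))\<^sup>2) \<partial>lebesgue)"

end

theory Submission
  imports Defs "HOL-Probability.Probability_Measure"
begin

text \<open>
  Write \<open>k(x, y) = W(x - y) - (W * \<rho>)(x)\<close>, so that \<open>\<integral> k(x, y) \<rho>(y) dy = 0\<close>. Since
  \<open>\<rho> \<propto> exp (- \<beta> (U + W * \<rho>))\<close>, the law of \<open>X\<^sub>i\<close> given the other particles has density proportional to
  \<open>\<rho> exp (- \<beta> h\<^sub>i)\<close> with \<open>h\<^sub>i(t) = (\<Sum>\<^sub>j k(t, X\<^sub>j)) / (N - 1)\<close>, \<open>j \<noteq> i\<close>. For a test function \<open>f\<close> with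
  \<open>\<bar>f\<bar> \<le> 1\<close> and \<open>\<integral> f \<rho> = 0\<close> its conditional mean is therefore \<open>O(\<beta> \<integral> \<bar>h\<^sub>i\<bar> \<rho>)\<close>. Expanding
  \<open>E (\<Sum>\<^sub>i f(X\<^sub>i))\<^sup>2\<close> over pairs, the diagonal gives \<open>N\<close>, and by Cauchy--Schwarz the off-diagonal part is
  a small multiple of the supremum \<open>D\<close> of these second moments over all test functions, because
  \<open>k(t, \<cdot>)\<close> is, up to a factor, a test function itself. For small \<open>\<beta>\<close> this yields
  \<open>D \<le> N + (D + 1) / 2\<close>, that is \<open>D \<le> 3 N\<close>. Taking \<open>f\<close> to be the cosine and sine of \<open>\<xi> \<cdot> x\<close>, centered,
  bounds \<open>E \<bar>\<mu>\<^sub>N^(\<xi>) - \<rho>^(\<xi>)\<bar>\<^sup>2\<close> by \<open>24 / N\<close> uniformly in \<open>\<xi>\<close>, and \<open>(1 + \<bar>\<xi>\<bar>\<^sup>2) powr (- \<alpha>)\<close> is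
  integrable.

  The equation \<open>\<rho> \<propto> exp (- \<beta> (U + W * \<rho>))\<close> is solved by contraction in the potential \<open>W * \<rho>\<close>. Around its
  solution the free energy exceeds the minimum by \<open>1 / \<beta>\<close> times the relative entropy plus a
  quadratic interaction term, which the squared Hellinger distance controls; so the solution is
  the unique minimizer.
\<close>

section \<open>Second moments in a weakly interacting gas\<close>

lemma abs_exp_minus_one_le:
  fixes u :: real
  assumes "\<bar>u\<bar> \<le> 1"
  shows "\<bar>exp u - 1\<bar> \<le> 2 * \<bar>u\<bar>"
proof (cases "u \<ge> 0")
  case True
  with assms have "exp u \<le> 1 + u + u\<^sup>2" by (intro exp_bound) auto
  moreover have "u\<^sup>2 \<le> u" using True assms by (simp add: power2_eq_square mult_left_le)
  ultimately show ?thesis using True by simp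
next
  case False
  moreover have "1 + u \<le> exp u" by (rule exp_ge_add_one_self)
  moreover from False have "exp u \<le> 1" by simp
  ultimately show ?thesis by linarith
qed

text \<open>In the application \<open>R\<close> is the self-consistent one-particle law and
  \<open>G x y\<close> is \<open>W (x - y)\<close>. The constant 64 makes the factor
  \<open>16 * (\<beta> * B) * (card I / (card I - 1))\<close> in the second-moment recursion at most
  1/2.\<close>

locale mean_field_gas = prob_space R for R :: "'a measure" +
  fixes G :: "'a \<Rightarrow> 'a \<Rightarrow> real" and B \<beta> :: real and I :: "'i set"
  assumes G_measurable: "case_prod G \<in> borel_measurable (R \<Otimes>\<^sub>M R)"
    and G_bound: "\<And>x y. \<bar>G x y\<bar> \<le> B"
    and G_commute: "\<And>x y. G x y = G y x"
    and B_pos: "0 < B"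
    and finite_I: "finite I"
    and card_I: "2 \<le> card I"
    and \<beta>_nonneg: "0 \<le> \<beta>"
    and \<beta>_small: "64 * \<beta> * B \<le> 1"
begin

abbreviation Q :: "('i \<Rightarrow> 'a) measure" where "Q \<equiv> (\<Pi>\<^sub>M i\<in>I. R)"

definition pot :: "'a \<Rightarrow> real" where "pot x = (LINT y|R. G x y)"

text \<open>The pair energy with its mean field taken out: the one-body terms \<open>pot\<close> are
  absorbed into the reference law \<open>R\<close>, so only fluctuations are left to
  \<open>weight\<close>.\<close>

definition ham :: "('i \<Rightarrow> 'a) \<Rightarrow> real" where
  "ham x = 1 / (2 * (real (card I) - 1)) * (\<Sum>i\<in>I. \<Sum>j\<in>I - {i}. G (x i) (x j)) - (\<Sum>i\<in>I. pot (x i))"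

definition weight :: "('i \<Rightarrow> 'a) \<Rightarrow> real" where "weight x = exp (- \<beta> * ham x)"

text \<open>
  As a function of the \<open>i\<close>-th coordinate \<open>t\<close> alone, \<open>weight\<close> is a constant multiple of
  \<open>exp (- \<beta> * field i x t)\<close>.
\<close>

definition field :: "'i \<Rightarrow> ('i \<Rightarrow> 'a) \<Rightarrow> 'a \<Rightarrow> real" where
  "field i x t = 1 / (real (card I) - 1) * (\<Sum>j\<in>I - {i}. G t (x j) - pot t)"

text \<open>Expectations under the Gibbs measure, not normalized: divide by \<open>wmean (\<lambda>_. 1)\<close>.\<close>

definition wmean :: "(('i \<Rightarrow> 'a) \<Rightarrow> real) \<Rightarrow> real" where
  "wmean F = (LINT x|Q. weight x * F x)"

definition centered :: "('a \<Rightarrow> real) \<Rightarrow> bool" where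
  "centered f \<longleftrightarrow> f \<in> borel_measurable R \<and> (\<forall>x. \<bar>f x\<bar> \<le> 1) \<and> (LINT x|R. f x) = 0"

sublocale Q: finite_product_prob_space "\<lambda>_. R" I
  by standard (rule finite_I)
sublocale QR: pair_prob_space Q R ..

lemma card_I_gt: "real (card I) - 1 > 0"
  using card_I by simp

lemma card_Diff: "i \<in> I \<Longrightarrow> real (card (I - {i})) = real (card I) - 1"
  using card_I by (simp add: of_nat_diff)

lemma measurable_G [measurable (raw)]:
  assumes "f \<in> M \<rightarrow>\<^sub>M R" "g \<in> M \<rightarrow>\<^sub>M R"
  shows "(\<lambda>x. G (f x) (g x)) \<in> borel_measurable M"
  using measurable_compose[OF measurable_Pair[OF assms] G_measurable] by simp

lemma integrable_G: "x \<in> space R \<Longrightarrow> integrable R (G x)"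
  by (intro integrable_const_bound[where B=B]) (auto simp: G_bound)

lemma measurable_pot [measurable]: "pot \<in> borel_measurable R"
  unfolding pot_def[abs_def] by measurable

lemma integral_bounded:
  assumes "\<And>t. \<bar>f t\<bar> \<le> C"
  shows "\<bar>LINT t|R. f t\<bar> \<le> (C::real)"
proof (cases "integrable R f")
  case True
  have "\<bar>LINT t|R. f t\<bar> \<le> (LINT t|R. \<bar>f t\<bar>)" by (rule integral_abs_bound)
  also have "\<dots> \<le> (LINT t|R. C)" using True by (intro integral_mono) (auto simp: assms)
  finally show ?thesis by (simp add: prob_space)
next
  \<comment> \<open>A non-integrable function has integral 0 by convention, and
    \<open>0 \<le> C\<close>.\<close>
  case False
  moreover have "0 \<le> C" using assms[of undefined] by linarith
  ultimately show ?thesis by (simp add: not_integrable_integral_eq)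
qed

lemma abs_pot_le: "\<bar>pot x\<bar> \<le> B"
  unfolding pot_def by (rule integral_bounded) (rule G_bound)

lemma measurable_ham [measurable]: "ham \<in> borel_measurable Q"
  unfolding ham_def[abs_def] by measurable

lemma measurable_weight [measurable]: "weight \<in> borel_measurable Q"
  unfolding weight_def[abs_def] by measurable

lemma weight_pos: "0 < weight x"
  by (simp add: weight_def)

text \<open>The bound \<open>exp (\<beta> * C)\<close> grows exponentially with
  \<open>card I\<close>; it serves only to establish integrability and enters no estimate.\<close>

lemma weight_bounded: "\<exists>C. \<forall>x. \<bar>weight x\<bar> \<le> C"
proof -
  define C where "C = 1 / (2 * (real (card I) - 1)) * (\<Sum>i\<in>I. \<Sum>j\<in>I - {i}. B) + (\<Sum>i\<in>I. B)"
  have "- ham x \<le> C" for x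
  proof -
    have "(\<Sum>i\<in>I. \<Sum>j\<in>I - {i}. - G (x i) (x j)) \<le> (\<Sum>i\<in>I. \<Sum>j\<in>I - {i}. B)"
      using G_bound by (intro sum_mono) (smt (verit, best))
    then have "1 / (2 * (real (card I) - 1)) * (\<Sum>i\<in>I. \<Sum>j\<in>I - {i}. - G (x i) (x j))
        \<le> 1 / (2 * (real (card I) - 1)) * (\<Sum>i\<in>I. \<Sum>j\<in>I - {i}. B)"
      using card_I_gt by (intro mult_left_mono) auto
    moreover have "(\<Sum>i\<in>I. pot (x i)) \<le> (\<Sum>i\<in>I. B)"
      using abs_pot_le by (intro sum_mono) (smt (verit, best))
    ultimately show ?thesis unfolding ham_def C_def by (simp add: sum_negf)
  qed
  then have "weight x \<le> exp (\<beta> * C)" for x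
    unfolding weight_def using mult_left_mono[OF _ \<beta>_nonneg, of "- ham x" C] by auto
  then show ?thesis using weight_pos by (metis abs_of_pos)
qed

lemma integrable_weight_mult:
  assumes [measurable]: "F \<in> borel_measurable Q" and "\<And>x. \<bar>F x\<bar> \<le> C"
  shows "integrable Q (\<lambda>x. weight x * F x)"
proof -
  obtain C' where "\<And>x. \<bar>weight x\<bar> \<le> C'" using weight_bounded by auto
  then have "\<bar>weight x * F x\<bar> \<le> C' * C" for x
    using assms(2)[of x] by (simp add: abs_mult mult_mono')
  then show ?thesis by (intro Q.integrable_const_bound[where B="C' * C"]) auto
qed

section \<open>Resampling one coordinate of the product law\<close>

lemma measurable_update [measurable (raw)]:
  assumes "i \<in> I" and [measurable]: "f \<in> M \<rightarrow>\<^sub>M Q" "g \<in> M \<rightarrow>\<^sub>M R"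
  shows "(\<lambda>x. (f x)(i := g x)) \<in> M \<rightarrow>\<^sub>M Q"
proof (rule measurable_PiM_single')
  show "(\<lambda>x. ((f x)(i := g x)) k) \<in> M \<rightarrow>\<^sub>M R" if "k \<in> I" for k
    using that by (cases "k = i") simp_all
  show "(\<lambda>x k. ((f x)(i := g x)) k) \<in> space M \<rightarrow> (\<Pi>\<^sub>E i\<in>I. space R)"
    using assms(1) measurable_space[OF assms(2)] measurable_space[OF assms(3)]
    by (fastforce simp: space_PiM PiE_iff extensional_def)
qed

text \<open>Redrawing coordinate \<open>i\<close> independently does not change a product law. By
  Fubini both sides become integrals over the other coordinates and coordinate \<open>i\<close>; on
  the resampled side the first draw is overwritten and integrates to 1.\<close>

lemma resample:
  assumes i: "i \<in> I" and [measurable]: "(F :: _ \<Rightarrow> real) \<in> borel_measurable Q" and bd: "\<And>x. \<bar>F x\<bar> \<le> C"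
  shows "(LINT x|Q. F x) = (LINT x|Q. LINT t|R. F (x(i := t)))"
proof -
  let ?J = "I - {i}"
  have ins: "I = insert i ?J" and fin: "finite ?J" using i finite_I by auto
  have meas [measurable]: "(\<lambda>x. LINT t|R. F (x(i := t))) \<in> borel_measurable Q"
    using i by measurable
  have bd': "\<bar>LINT t|R. F (x(i := t))\<bar> \<le> C" for x
    by (rule integral_bounded) (rule bd)
  have int: "integrable Q F" "integrable Q (\<lambda>x. LINT t|R. F (x(i := t)))"
    using bd bd' by (auto intro!: Q.integrable_const_bound[where B=C])
  have "(LINT x|Q. LINT t|R. F (x(i := t)))
      = (LINT x|Pi\<^sub>M ?J (\<lambda>_. R). LINT y|R. LINT t|R. F ((x(i := y))(i := t)))"
    using Q.product_integral_insert[OF fin, of i "\<lambda>x. LINT t|R. F (x(i := t))"] int(2) by (simp add: insert_absorb[OF i])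
  also have "\<dots> = (LINT x|Pi\<^sub>M ?J (\<lambda>_. R). LINT t|R. F (x(i := t)))"
    by (simp add: prob_space)
  also have "\<dots> = (LINT x|Q. F x)"
    using Q.product_integral_insert[OF fin, of i F] int(1) by (simp add: insert_absorb[OF i])
  finally show ?thesis by simp
qed

text \<open>The sum runs over ordered pairs, so each pair containing \<open>i\<close> occurs twice,
  with equal contributions because \<open>G\<close> is symmetric. The factor 2 later cancels the 1/2
  in \<open>ham\<close>.\<close>

lemma sum_pairs_remove:
  assumes "i \<in> I"
  shows "(\<Sum>k\<in>I. \<Sum>j\<in>I - {k}. G (x k) (x j)) =
    2 * (\<Sum>j\<in>I - {i}. G (x i) (x j)) +
    (\<Sum>k\<in>I - {i}. \<Sum>j\<in>I - {i} - {k}. G (x k) (x j))"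
proof -
  have "(\<Sum>j\<in>I - {k}. G (x k) (x j)) = G (x i) (x k) + (\<Sum>j\<in>I - {i} - {k}. G (x k) (x j))"
    if "k \<in> I - {i}" for k
  proof -
    have "I - {k} - {i} = I - {i} - {k}" by auto
    with that assms finite_I show ?thesis
      by (subst sum.remove[of _ i]) (auto simp: G_commute[of "x k" "x i"])
  qed
  then have "(\<Sum>k\<in>I - {i}. \<Sum>j\<in>I - {k}. G (x k) (x j)) =
     (\<Sum>k\<in>I - {i}. G (x i) (x k) + (\<Sum>j\<in>I - {i} - {k}. G (x k) (x j)))"
    by (intro sum.cong) auto
  with assms finite_I show ?thesis
    by (subst sum.remove[of _ i]) (auto simp: sum.distrib)
qed

lemma ham_update:
  assumes i: "i \<in> I"
  shows "ham (x(i := t)) - ham x = field i x t - field i x (x i)"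
proof -
  note card = card_Diff[OF i]
  have "(\<Sum>j\<in>I. pot (y j)) = pot (y i) + (\<Sum>j\<in>I - {i}. pot (y j))" for y
    using finite_I i by (rule sum.remove)
  moreover have "1 / (2 * (real (card I) - 1)) * (2 * a) = 1 / (real (card I) - 1) * a" for a
    using card_I_gt by (simp add: field_simps)
  ultimately have split: "ham y = 1 / (real (card I) - 1) * (\<Sum>j\<in>I - {i}. G (y i) (y j)) - pot (y i)
     + (1 / (2 * (real (card I) - 1)) * (\<Sum>k\<in>I - {i}. \<Sum>j\<in>I - {i} - {k}. G (y k) (y j))
     - (\<Sum>k\<in>I - {i}. pot (y k)))" for y
    unfolding ham_def sum_pairs_remove[OF i] distrib_left by simp
  \<comment> \<open>The one-body term \<open>pot s\<close> is distributed evenly over the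
    \<open>card I - 1\<close> partners of \<open>i\<close>, which centers each summand of
    \<open>field\<close> separately.\<close>
  have "field i x s = 1 / (real (card I) - 1) * (\<Sum>j\<in>I - {i}. G s (x j)) - pot s" for s
    unfolding field_def sum_subtractf sum_constant card using card_I_gt by (simp add: field_simps)
  then show ?thesis
    unfolding split[of "x(i := t)"] split[of x] by (simp add: fun_upd_def)
qed

lemma weight_update:
  assumes "i \<in> I"
  shows "weight (x(i := t)) = weight x * exp (\<beta> * field i x (x i)) * exp (- \<beta> * field i x t)"
proof -
  have eq: "ham (x(i := t)) = ham x + (field i x t - field i x (x i))"
    using ham_update[OF assms, of x t] by simp
  show ?thesis unfolding weight_def eq by (simp add: algebra_simps flip: exp_add)
qed

section \<open>Conditional means of test functions\<close>

lemma abs_G_minus_pot_le: "\<bar>G t y - pot t\<bar> \<le> 2 * B"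
  using G_bound[of t y] abs_pot_le[of t] by linarith

lemma abs_field_le:
  assumes "i \<in> I"
  shows "\<bar>field i x t\<bar> \<le> 2 * B"
proof -
  note card = card_Diff[OF assms]
  have "\<bar>\<Sum>j\<in>I - {i}. G t (x j) - pot t\<bar> \<le> (\<Sum>j\<in>I - {i}. 2 * B)"
    by (rule order_trans[OF sum_abs sum_mono[OF abs_G_minus_pot_le]])
  also have "\<dots> = (real (card I) - 1) * (2 * B)" unfolding sum_constant card ..
  finally show ?thesis using card_I_gt by (simp add: field_def abs_mult field_simps)
qed

lemma field_update: "field i (x(i := y)) t = field i x t"
  by (simp add: field_def)

lemma measurable_field [measurable (raw)]:
  assumes [measurable]: "f \<in> M \<rightarrow>\<^sub>M Q" "g \<in> M \<rightarrow>\<^sub>M R"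
  shows "(\<lambda>x. field i (f x) (g x)) \<in> borel_measurable M"
  unfolding field_def by measurable


lemma integrable_field: "x \<in> space Q \<Longrightarrow> i \<in> I \<Longrightarrow> integrable R (field i x)"
  by (intro integrable_const_bound[where B="2 * B"]) (auto simp: abs_field_le)

lemma abs_field_scaled_le: "i \<in> I \<Longrightarrow> \<bar>\<beta> * field i x t\<bar> \<le> 1 / 32"
  using mult_left_mono[OF abs_field_le[of i x t] \<beta>_nonneg] \<beta>_small \<beta>_nonneg by (simp add: abs_mult)

text \<open>The conditional mean of \<open>f\<close> in coordinate \<open>i\<close>, multiplied
  through by its normalization. As \<open>f\<close> has mean zero under \<open>R\<close>, the factor
  \<open>exp (- \<beta> * field i x t)\<close> may be replaced by its difference from 1, which is of
  first order in \<beta>. The normalization of this factor is at least 1/2, so inserting it on the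
  right costs a factor 2.\<close>

lemma integral_centered_weight:
  assumes i: "i \<in> I" and x[simp]: "x \<in> space Q" and f: "centered f"
  shows "\<bar>LINT t|R. weight (x(i := t)) * f t\<bar>
    \<le> 4 * \<beta> * (LINT s|R. \<bar>field i x s\<bar>) * (LINT t|R. weight (x(i := t)))"
proof -
  let ?e = "\<lambda>t. exp (- \<beta> * field i x t)"
  have [measurable]: "f \<in> borel_measurable R" and f1: "\<And>t. \<bar>f t\<bar> \<le> 1" and f0: "(LINT t|R. f t) = 0"
    using f by (auto simp: centered_def)
  have le: "\<bar>?e t - 1\<bar> \<le> 2 * \<beta> * \<bar>field i x t\<bar>" for t
    using abs_exp_minus_one_le[of "- \<beta> * field i x t"] abs_field_scaled_le[OF i, of x t] \<beta>_nonneg by (simp add: abs_mult)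
  have e_ge: "1 / 2 \<le> ?e t" and e_le: "?e t \<le> 2" for t
  proof -
    have "2 * \<beta> * \<bar>field i x t\<bar> \<le> 1 / 16"
      using abs_field_scaled_le[OF i, of x t] \<beta>_nonneg by (simp add: abs_mult)
    with le[of t] show "1 / 2 \<le> ?e t" "?e t \<le> 2" by linarith+
  qed
  have int_f: "integrable R f" by (intro integrable_const_bound[where B=1]) (auto simp: f1)
  have "\<bar>?e t\<bar> \<le> 2" for t using e_le[of t] by simp
  then have int_e: "integrable R ?e" by (intro integrable_const_bound[where B=2] AE_I2) simp_all
  have int_ef: "integrable R (\<lambda>t. ?e t * f t)"
  proof (intro integrable_const_bound[where B="2 * 1"] AE_I2)
    show "norm (?e t * f t) \<le> 2 * 1" for t
      using e_le[of t] f1[of t] unfolding real_norm_def abs_mult by (intro mult_mono) auto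
  qed (use x in measurable)
  have int_h: "integrable R (\<lambda>t. \<bar>field i x t\<bar>)" using integrable_field[OF x i] by simp
  have "(LINT t|R. ?e t * f t) = (LINT t|R. (?e t - 1) * f t)"
    using int_f int_ef by (simp add: left_diff_distrib f0)
  also have "\<bar>\<dots>\<bar> \<le> (LINT t|R. \<bar>(?e t - 1) * f t\<bar>)" by (rule integral_abs_bound)
  also have "\<dots> \<le> (LINT t|R. 2 * \<beta> * \<bar>field i x t\<bar>)"
  proof (rule integral_mono)
    show "integrable R (\<lambda>t. \<bar>(?e t - 1) * f t\<bar>)"
      using int_f int_ef by (simp add: left_diff_distrib)
    show "integrable R (\<lambda>t. 2 * \<beta> * \<bar>field i x t\<bar>)" using int_h by simp
    show "\<bar>(?e t - 1) * f t\<bar> \<le> 2 * \<beta> * \<bar>field i x t\<bar>" for t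
      using mult_mono[OF le[of t] f1[of t]] \<beta>_nonneg by (simp add: abs_mult)
  qed
  finally have 1: "\<bar>LINT t|R. ?e t * f t\<bar> \<le> 2 * \<beta> * (LINT t|R. \<bar>field i x t\<bar>)" by simp
  have "(LINT t|R. 1 / 2) \<le> (LINT t|R. ?e t)"
    using int_e e_ge by (intro integral_mono) auto
  then have half: "1 / 2 \<le> (LINT t|R. ?e t)" by (simp add: prob_space)
  have "0 \<le> \<beta> * (LINT s|R. \<bar>field i x s\<bar>)" using \<beta>_nonneg by simp
  from mult_left_mono[OF half this]
  have 2: "\<bar>LINT t|R. ?e t * f t\<bar> \<le> 4 * \<beta> * (LINT s|R. \<bar>field i x s\<bar>) * (LINT t|R. ?e t)"
    using 1 by linarith
  define c where "c = weight x * exp (\<beta> * field i x (x i))"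
  have c: "0 \<le> c" using weight_pos[of x] by (simp add: c_def)
  have w: "weight (x(i := t)) = c * ?e t" for t by (simp add: weight_update[OF i] c_def)
  have "\<bar>LINT t|R. weight (x(i := t)) * f t\<bar> = c * \<bar>LINT t|R. ?e t * f t\<bar>"
    unfolding w mult.assoc using c by (simp add: abs_mult)
  also have "\<dots> \<le> c * (4 * \<beta> * (LINT s|R. \<bar>field i x s\<bar>) * (LINT t|R. ?e t))"
    by (rule mult_left_mono[OF 2 c])
  also have "\<dots> = 4 * \<beta> * (LINT s|R. \<bar>field i x s\<bar>) * (LINT t|R. weight (x(i := t)))"
    unfolding w by simp
  finally show ?thesis .
qed

text \<open>Resampling coordinate \<open>i\<close> lets \<open>g\<close>, which does not depend on
  it, leave the inner integral, so that \<open>integral_centered_weight\<close> applies for each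
  configuration. Fubini finally moves \<open>s\<close> outside: for fixed \<open>s\<close> the field
  is a sum of one fixed kernel over the other particles.\<close>

lemma wmean_centered_mult:
  assumes i: "i \<in> I" and f: "centered f"
    and [measurable]: "g \<in> borel_measurable Q" and g_bound: "\<And>x. \<bar>g x\<bar> \<le> C"
    and g_update: "\<And>x t. g (x(i := t)) = g x"
  shows "\<bar>wmean (\<lambda>x. f (x i) * g x)\<bar> \<le> 4 * \<beta> * (LINT s|R. wmean (\<lambda>x. \<bar>g x\<bar> * \<bar>field i x s\<bar>))"
proof -
  have [measurable]: "f \<in> borel_measurable R" and f1: "\<And>t. \<bar>f t\<bar> \<le> 1" 
    using f by (auto simp: centered_def)
  note i[measurable]
  obtain K where K: "\<And>x. \<bar>weight x\<bar> \<le> K" using weight_bounded by auto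
  let ?H = "\<lambda>x. LINT s|R. \<bar>field i x s\<bar>"
  have H: "\<bar>?H x\<bar> \<le> 2 * B" for x
    using i by (intro integral_bounded) (auto intro: abs_field_le)
  have C: "0 \<le> C" using g_bound[of undefined] by linarith
  have K0: "0 \<le> K" using K[of undefined] by linarith
  have meas_w [measurable]: "(\<lambda>x. LINT t|R. weight (x(i := t))) \<in> borel_measurable Q"
    using i by measurable
  have b1: "\<bar>weight x * (f (x i) * g x)\<bar> \<le> K * (1 * C)" for x
    unfolding abs_mult using C K0 by (intro mult_mono K f1 g_bound) auto
  have b2: "\<bar>weight x * (\<bar>g x\<bar> * ?H x)\<bar> \<le> K * (C * (2 * B))" for x
    unfolding abs_mult using C K0 H g_bound by (intro mult_mono K) auto
  have "wmean (\<lambda>x. f (x i) * g x) = (LINT x|Q. LINT t|R. weight (x(i := t)) * (f t * g x))"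
    unfolding wmean_def using b1 by (subst resample[OF i]) (auto simp: g_update)
  also have "\<dots> = (LINT x|Q. g x * (LINT t|R. weight (x(i := t)) * f t))"
    unfolding mult.assoc[symmetric] integral_mult_left_zero by (simp only: mult.commute)
  also have "\<bar>\<dots>\<bar> \<le> (LINT x|Q. \<bar>g x * (LINT t|R. weight (x(i := t)) * f t)\<bar>)" 
    by (rule integral_abs_bound)
  also have "\<dots> \<le> (LINT x|Q. \<bar>g x\<bar> * (4 * \<beta> * ?H x * (LINT t|R. weight (x(i := t)))))"
  proof (rule integral_mono_AE)
    have "\<bar>LINT t|R. weight (x(i := t)) * f t\<bar> \<le> K * 1" for x
      unfolding abs_mult by (intro integral_bounded) (unfold abs_mult, intro mult_mono K f1 K0 abs_ge_zero)
    then show "integrable Q (\<lambda>x. \<bar>g x * (LINT t|R. weight (x(i := t)) * f t)\<bar>)"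
      by (intro Q.integrable_const_bound[where B="C * (K * 1)"] AE_I2)
        (auto simp: abs_mult intro!: mult_mono g_bound C)
    have W: "\<bar>LINT t|R. weight (x(i := t))\<bar> \<le> K" for x
      by (intro integral_bounded K)
    show "integrable Q (\<lambda>x. \<bar>g x\<bar> * (4 * \<beta> * ?H x * (LINT t|R. weight (x(i := t)))))"
    proof (intro Q.integrable_const_bound[where B="C * (4 * \<beta> * (2 * B) * K)"] AE_I2)
      show "norm (\<bar>g x\<bar> * (4 * \<beta> * ?H x * (LINT t|R. weight (x(i := t)))))
          \<le> C * (4 * \<beta> * (2 * B) * K)" for x
        unfolding real_norm_def abs_mult abs_idempotent
        using C \<beta>_nonneg B_pos K0 by (intro mult_mono g_bound H W mult_nonneg_nonneg) auto
    qed measurable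
    show "AE x in Q. \<bar>g x * (LINT t|R. weight (x(i := t)) * f t)\<bar>
        \<le> \<bar>g x\<bar> * (4 * \<beta> * ?H x * (LINT t|R. weight (x(i := t))))"
      unfolding abs_mult by (intro AE_I2 mult_left_mono integral_centered_weight i f) auto
  qed
  also have "\<dots> = (LINT x|Q. 4 * \<beta> * (LINT t|R. weight (x(i := t)) * (\<bar>g x\<bar> * ?H x)))"
    unfolding integral_mult_left_zero by (simp only: mult_ac)
  also have "\<dots> = 4 * \<beta> * (LINT x|Q. (LINT t|R. weight (x(i := t)) * (\<bar>g x\<bar> * ?H x)))"
    by (rule integral_mult_right_zero)
  \<comment> \<open>The resampling is undone: neither \<open>g\<close> nor
    \<open>field i x s\<close> depends on coordinate \<open>i\<close>.\<close>
  also have "(LINT x|Q. (LINT t|R. weight (x(i := t)) * (\<bar>g x\<bar> * ?H x)))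
      = (LINT x|Q. weight x * (\<bar>g x\<bar> * ?H x))"
    using b2 by (subst resample[OF i, of "\<lambda>x. weight x * (\<bar>g x\<bar> * ?H x)"]) (auto simp: g_update field_update)
  also have "\<dots> = (LINT x|Q. LINT s|R. weight x * (\<bar>g x\<bar> * \<bar>field i x s\<bar>))"
    by simp
  also have "\<dots> = (LINT s|R. wmean (\<lambda>x. \<bar>g x\<bar> * \<bar>field i x s\<bar>))"
    unfolding wmean_def
  proof (rule QR.Fubini_integral[symmetric])
    show "integrable (Q \<Otimes>\<^sub>M R) (\<lambda>(x, s). weight x * (\<bar>g x\<bar> * \<bar>field i x s\<bar>))"
      using K0 C i
      by (intro QR.integrable_const_bound[where B="K * (C * (2 * B))"] AE_I2)
        (auto simp: abs_mult intro!: mult_mono K g_bound abs_field_le)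
  qed
  finally show ?thesis .
qed


section \<open>Bounded observables and calculation rules for \<open>wmean\<close>\<close>

definition bounded_observable :: "(('i \<Rightarrow> 'a) \<Rightarrow> real) \<Rightarrow> bool" where
  "bounded_observable F \<longleftrightarrow> F \<in> borel_measurable Q \<and> (\<exists>C. \<forall>x. \<bar>F x\<bar> \<le> C)"

lemma bounded_observable_const: "bounded_observable (\<lambda>x. c)"
  by (auto simp: bounded_observable_def)

lemma bounded_observable_add:
  assumes "bounded_observable F" "bounded_observable F'"
  shows "bounded_observable (\<lambda>x. F x + F' x)"
proof -
  obtain C C' where "\<And>x. \<bar>F x\<bar> \<le> C" "\<And>x. \<bar>F' x\<bar> \<le> C'" using assms by (auto simp: bounded_observable_def)
  then have "\<bar>F x + F' x\<bar> \<le> C + C'" for x by (meson abs_triangle_ineq add_mono order_trans)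
  with assms show ?thesis by (auto simp: bounded_observable_def)
qed

lemma bounded_observable_mult:
  assumes "bounded_observable F" "bounded_observable F'"
  shows "bounded_observable (\<lambda>x. F x * F' x)"
proof -
  obtain C C' where "\<And>x. \<bar>F x\<bar> \<le> C" "\<And>x. \<bar>F' x\<bar> \<le> C'" using assms by (auto simp: bounded_observable_def)
  then have "\<bar>F x * F' x\<bar> \<le> C * C'" for x unfolding abs_mult by (intro mult_mono') auto
  with assms show ?thesis by (auto simp: bounded_observable_def)
qed

lemma bounded_observable_power2: "bounded_observable F \<Longrightarrow> bounded_observable (\<lambda>x. (F x)\<^sup>2)"
  unfolding power2_eq_square by (intro bounded_observable_mult)

lemma bounded_observable_sum: "(\<And>j. j \<in> J \<Longrightarrow> bounded_observable (F j)) \<Longrightarrow> bounded_observable (\<lambda>x. \<Sum>j\<in>J. F j x)"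
  by (induction J rule: infinite_finite_induct) (auto intro: bounded_observable_const bounded_observable_add)

lemma bounded_observable_abs: "bounded_observable F \<Longrightarrow> bounded_observable (\<lambda>x. \<bar>F x\<bar>)"
  by (auto simp: bounded_observable_def)

lemma bounded_observable_centered: "centered f \<Longrightarrow> i \<in> I \<Longrightarrow> bounded_observable (\<lambda>x. f (x i))"
  unfolding bounded_observable_def centered_def by (auto intro!: exI[of _ 1])

lemma bounded_observable_integrable: "bounded_observable F \<Longrightarrow> integrable Q (\<lambda>x. weight x * F x)"
  unfolding bounded_observable_def using integrable_weight_mult by blast

lemma wmean_add: "bounded_observable F \<Longrightarrow> bounded_observable F' \<Longrightarrow> wmean (\<lambda>x. F x + F' x) = wmean F + wmean F'"
  unfolding wmean_def distrib_left by (intro Bochner_Integration.integral_add bounded_observable_integrable)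

lemma wmean_cmult: "wmean (\<lambda>x. c * F x) = c * wmean F"
  unfolding wmean_def by (simp add: mult.left_commute[of _ c])

lemma wmean_sum: "(\<And>j. j \<in> J \<Longrightarrow> bounded_observable (F j)) \<Longrightarrow> wmean (\<lambda>x. \<Sum>j\<in>J. F j x) = (\<Sum>j\<in>J. wmean (F j))"
  unfolding wmean_def sum_distrib_left by (intro Bochner_Integration.integral_sum bounded_observable_integrable)

lemma wmean_mono: "bounded_observable F \<Longrightarrow> bounded_observable F' \<Longrightarrow> (\<And>x. F x \<le> F' x) \<Longrightarrow> wmean F \<le> wmean F'"
  unfolding wmean_def by (intro integral_mono bounded_observable_integrable mult_left_mono) (auto intro: weight_pos less_imp_le)

lemma wmean_1_pos: "0 < wmean (\<lambda>_. 1)"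
proof -
  have int: "integrable Q weight" using bounded_observable_integrable[OF bounded_observable_const[of 1]] by simp
  have "0 \<le> (LINT x|Q. weight x)" by (intro Bochner_Integration.integral_nonneg) (simp add: weight_pos less_imp_le)
  moreover have "(LINT x|Q. weight x) \<noteq> 0"
  proof
    assume "(LINT x|Q. weight x) = 0"
    then have "AE x in Q. weight x = 0"
      using int weight_pos by (subst (asm) integral_nonneg_eq_0_iff_AE) (auto intro: less_imp_le)
    then have "AE x in Q. False" using weight_pos by (auto simp: less_le)
    then show False by simp
  qed
  ultimately show ?thesis by (simp add: wmean_def)
qed

text \<open>This closes the recursion: \<open>field i x s\<close> is
  \<open>2 * B / (card I - 1)\<close> times the sum of this test function over the particles other
  than \<open>i\<close>.\<close>

lemma centered_field_kernel:
  assumes "s \<in> space R"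
  shows "centered (\<lambda>y. (G s y - pot s) / (2 * B))"
  using assms B_pos abs_G_minus_pot_le[of s] integrable_G[OF assms]
  by (auto simp: centered_def prob_space pot_def[symmetric])

text \<open>Leaving out one particle changes the sum by at most 1, and
  \<open>b\<^sup>2 \<le> 2 * (a + b)\<^sup>2 + 2 * a\<^sup>2\<close>.\<close>

lemma wmean_power2_sum_Diff_le:
  assumes f: "centered f" and i: "i \<in> I"
    and D: "wmean (\<lambda>x. (\<Sum>j\<in>I. f (x j))\<^sup>2) \<le> D * wmean (\<lambda>_. 1)"
  shows "wmean (\<lambda>x. (\<Sum>j\<in>I - {i}. f (x j))\<^sup>2) \<le> (2 * D + 2) * wmean (\<lambda>_. 1)"
proof -
  have "wmean (\<lambda>x. (\<Sum>j\<in>I - {i}. f (x j))\<^sup>2) \<le> wmean (\<lambda>x. 2 * (\<Sum>j\<in>I. f (x j))\<^sup>2 + 2 * 1)"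
  proof (rule wmean_mono)
    show "(\<Sum>j\<in>I - {i}. f (x j))\<^sup>2 \<le> 2 * (\<Sum>j\<in>I. f (x j))\<^sup>2 + 2 * 1" for x
    proof -
      have "(\<Sum>j\<in>I. f (x j)) = f (x i) + (\<Sum>j\<in>I - {i}. f (x j))"
        using finite_I i by (rule sum.remove)
      moreover have "\<bar>f (x i)\<bar> \<le> 1" using f by (simp add: centered_def)
      then have "(f (x i))\<^sup>2 \<le> 1" by (simp add: abs_square_le_1)
      moreover have "b\<^sup>2 \<le> 2 * (a + b)\<^sup>2 + 2 * a\<^sup>2" for a b :: real
      proof -
        have "2 * (a + b)\<^sup>2 + 2 * a\<^sup>2 - b\<^sup>2 = (2 * a + b)\<^sup>2" by (simp add: power2_eq_square algebra_simps)
        then show ?thesis by (metis diff_ge_0_iff_ge zero_le_power2)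
      qed
      ultimately show ?thesis by (smt (verit, best))
    qed
  qed (use f i in \<open>auto intro!: bounded_observable_power2 bounded_observable_sum bounded_observable_centered bounded_observable_add bounded_observable_mult bounded_observable_const\<close>)
  also have "\<dots> = 2 * wmean (\<lambda>x. (\<Sum>j\<in>I. f (x j))\<^sup>2) + 2 * wmean (\<lambda>_. 1)"
    using f by (subst wmean_add) (auto simp: wmean_cmult wmean_cmult[of 2 "\<lambda>_. 1", simplified]
      intro!: bounded_observable_power2 bounded_observable_sum bounded_observable_centered bounded_observable_mult bounded_observable_const)
  finally show ?thesis using D by (simp add: algebra_simps)
qed

text \<open>
  The bound \<open>D\<close> is assumed for all test functions, since it is also applied to the kernel
  \<open>G s y - pot s\<close>.
\<close>

lemma wmean_power2_sum_rec:
  assumes D: "\<And>f. centered f \<Longrightarrow> wmean (\<lambda>x. (\<Sum>j\<in>I. f (x j))\<^sup>2) \<le> D * wmean (\<lambda>_. 1)"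
    and f: "centered f"
  shows "wmean (\<lambda>x. (\<Sum>j\<in>I. f (x j))\<^sup>2) \<le> (card I + (D + 1) / 2) * wmean (\<lambda>_. 1)"
proof -
  let ?Z = "wmean (\<lambda>_. 1)"
  let ?g = "\<lambda>f i x. \<Sum>j\<in>I - {i}. f (x j)"
  have f1: "\<bar>f t\<bar> \<le> 1" for t using f by (simp add: centered_def)
  have bounded_observable_g: "bounded_observable (?g h i)" if "centered h" for h i using that by (intro bounded_observable_sum bounded_observable_centered) auto
  have bounded_observable_sq: "bounded_observable (\<lambda>x. 1 / 2 * (?g h i x)\<^sup>2)" if "centered h" for h i
    by (rule bounded_observable_mult[OF bounded_observable_const bounded_observable_power2[OF bounded_observable_g[OF that]]])
  have amgm: "\<bar>a\<bar> * \<bar>b\<bar> \<le> 1 / 2 * a\<^sup>2 + 1 / 2 * b\<^sup>2" for a b :: real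
    using sum_squares_bound[of "\<bar>a\<bar>" "\<bar>b\<bar>"] by simp
  have D0: "0 \<le> D"
  proof -
    have "0 \<le> wmean (\<lambda>x. (\<Sum>j\<in>I. f (x j))\<^sup>2)"
      unfolding wmean_def by (intro Bochner_Integration.integral_nonneg) (simp add: weight_pos less_imp_le)
    also have "\<dots> \<le> D * ?Z" by (rule D[OF f])
    finally show ?thesis using wmean_1_pos by (simp add: zero_le_mult_iff)
  qed
  \<comment> \<open>The cross terms of particle \<open>i\<close>. For each fixed \<open>s\<close>
    the product of two sums is split by the arithmetic-geometric mean inequality into two second
    moments, one of \<open>f\<close> and one of the field kernel; the hypothesis \<open>D\<close>
    bounds both.\<close>
  have off: "wmean (\<lambda>x. f (x i) * ?g f i x) \<le> 4 * \<beta> * (2 * B / (real (card I) - 1) * ((2 * D + 2) * ?Z))"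
    if i: "i \<in> I" for i
  proof -
    obtain C where C: "\<And>x. \<bar>?g f i x\<bar> \<le> C" using bounded_observable_g[OF f, of i] by (auto simp: bounded_observable_def)
    have s: "wmean (\<lambda>x. \<bar>?g f i x\<bar> * \<bar>field i x s\<bar>) \<le> 2 * B / (real (card I) - 1) * ((2 * D + 2) * ?Z)"
      if "s \<in> space R" for s
    proof -
      let ?k = "\<lambda>y. (G s y - pot s) / (2 * B)"
      note k = centered_field_kernel[OF that]
      have field: "field i x s = 2 * B / (real (card I) - 1) * ?g ?k i x" for x
        using B_pos by (simp add: field_def flip: sum_divide_distrib)
      have "wmean (\<lambda>x. \<bar>?g f i x\<bar> * \<bar>?g ?k i x\<bar>)
          \<le> wmean (\<lambda>x. 1 / 2 * (?g f i x)\<^sup>2 + 1 / 2 * (?g ?k i x)\<^sup>2)"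
      proof (rule wmean_mono)
        show "\<bar>?g f i x\<bar> * \<bar>?g ?k i x\<bar> \<le> 1 / 2 * (?g f i x)\<^sup>2 + 1 / 2 * (?g ?k i x)\<^sup>2" for x
          by (rule amgm)
      qed (rule bounded_observable_mult[OF bounded_observable_abs[OF bounded_observable_g[OF f]]
          bounded_observable_abs[OF bounded_observable_g[OF k]]] bounded_observable_add[OF bounded_observable_sq[OF f] bounded_observable_sq[OF k]])+
      also have "\<dots> = 1 / 2 * wmean (\<lambda>x. (?g f i x)\<^sup>2) + 1 / 2 * wmean (\<lambda>x. (?g ?k i x)\<^sup>2)"
        unfolding wmean_add[OF bounded_observable_sq[OF f] bounded_observable_sq[OF k]] wmean_cmult ..
      also have "\<dots> \<le> (2 * D + 2) * ?Z"
        using wmean_power2_sum_Diff_le[OF f i D[OF f]] wmean_power2_sum_Diff_le[OF k i D[OF k]] by simp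
      finally have "wmean (\<lambda>x. \<bar>?g f i x\<bar> * \<bar>?g ?k i x\<bar>) \<le> (2 * D + 2) * ?Z" .
      moreover have "wmean (\<lambda>x. \<bar>?g f i x\<bar> * \<bar>field i x s\<bar>)
          = 2 * B / (real (card I) - 1) * wmean (\<lambda>x. \<bar>?g f i x\<bar> * \<bar>?g ?k i x\<bar>)"
        using B_pos card_I_gt unfolding field wmean_cmult[symmetric] by (simp add: abs_mult mult_ac)
      ultimately show ?thesis using B_pos card_I_gt by (simp add: mult_left_mono del: times_divide_eq_left)
    qed
    have 1: "wmean (\<lambda>x. f (x i) * ?g f i x) \<le> 4 * \<beta> * (LINT s|R. wmean (\<lambda>x. \<bar>?g f i x\<bar> * \<bar>field i x s\<bar>))"
      using wmean_centered_mult[OF i f _ C] bounded_observable_g[OF f, of i] by (simp add: bounded_observable_def abs_le_iff)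
    have "(LINT s|R. wmean (\<lambda>x. \<bar>?g f i x\<bar> * \<bar>field i x s\<bar>))
        \<le> (LINT s|R. 2 * B / (real (card I) - 1) * ((2 * D + 2) * ?Z))"
    proof (rule integral_mono')
      \<comment> \<open>Nonnegativity of the bound covers the case of a non-integrable left-hand
        side, whose integral is 0.\<close>
      show "0 \<le> 2 * B / (real (card I) - 1) * ((2 * D + 2) * ?Z)"
        using B_pos card_I_gt D0 wmean_1_pos by simp
    qed (use s in auto)
    then have "(LINT s|R. wmean (\<lambda>x. \<bar>?g f i x\<bar> * \<bar>field i x s\<bar>))
        \<le> 2 * B / (real (card I) - 1) * ((2 * D + 2) * ?Z)" by (simp add: prob_space)
    from mult_left_mono[OF this, of "4 * \<beta>"] 1 \<beta>_nonneg show ?thesis by linarith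
  qed
  have "(\<Sum>j\<in>I. f (x j))\<^sup>2 = (\<Sum>i\<in>I. (f (x i))\<^sup>2 + f (x i) * ?g f i x)" for x
  proof -
    have "(\<Sum>j\<in>I. f (x j)) = f (x i) + ?g f i x" if "i \<in> I" for i
      using finite_I that by (rule sum.remove)
    then show ?thesis
      unfolding power2_eq_square[of "sum _ _"] sum_distrib_right
      by (intro sum.cong) (auto simp: power2_eq_square distrib_left)
  qed
  then have "wmean (\<lambda>x. (\<Sum>j\<in>I. f (x j))\<^sup>2) = (\<Sum>i\<in>I. wmean (\<lambda>x. (f (x i))\<^sup>2) + wmean (\<lambda>x. f (x i) * ?g f i x))"
    by (simp add: wmean_sum wmean_add bounded_observable_power2 bounded_observable_centered f bounded_observable_add bounded_observable_mult bounded_observable_g)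
  also have "\<dots> \<le> (\<Sum>i\<in>I. ?Z + 4 * \<beta> * (2 * B / (real (card I) - 1) * ((2 * D + 2) * ?Z)))"
  proof (intro sum_mono add_mono off)
    show "wmean (\<lambda>x. (f (x i))\<^sup>2) \<le> ?Z" if "i \<in> I" for i
      using that f1 by (intro wmean_mono bounded_observable_power2 bounded_observable_centered f bounded_observable_const) (simp_all add: abs_square_le_1)
  qed
  also have "\<dots> = (card I + 16 * (\<beta> * B) * (card I / (real (card I) - 1)) * (D + 1)) * ?Z"
    using card_I_gt by (simp add: field_simps)
  finally have "wmean (\<lambda>x. (\<Sum>j\<in>I. f (x j))\<^sup>2)
      \<le> (card I + 16 * (\<beta> * B) * (card I / (real (card I) - 1)) * (D + 1)) * ?Z" .
  \<comment> \<open>Here \<open>\<beta> * B \<le> 1 / 64\<close>, and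
    \<open>card I / (card I - 1) \<le> 2\<close> because there are at least two particles; the
    product of the constants is 1/2.\<close>
  moreover have "16 * (\<beta> * B) * (card I / (real (card I) - 1)) * (D + 1) \<le> 16 * (1 / 64) * 2 * (D + 1)"
    using card_I_gt card_I \<beta>_small \<beta>_nonneg B_pos D0
    by (intro mult_mono mult_nonneg_nonneg) (auto simp: field_simps)
  then have "(card I + 16 * (\<beta> * B) * (card I / (real (card I) - 1)) * (D + 1)) * ?Z
      \<le> (card I + (D + 1) / 2) * ?Z"
    using wmean_1_pos by (intro mult_right_mono) auto
  ultimately show ?thesis by linarith
qed

theorem wmean_power2_sum_le:
  assumes f: "centered f"
  shows "wmean (\<lambda>x. (\<Sum>j\<in>I. f (x j))\<^sup>2) \<le> 3 * card I * wmean (\<lambda>_. 1)"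
proof -
  let ?Z = "wmean (\<lambda>_. 1)" and ?v = "\<lambda>f. wmean (\<lambda>x. (\<Sum>j\<in>I. f (x j))\<^sup>2)"
  define V where "V = (\<lambda>f. ?v f / ?Z) ` Collect centered"
  \<comment> \<open>This crude bound only makes the supremum finite, so that the inequality in which
    it appears on both sides can be solved for it.\<close>
  have "?v h \<le> (real (card I))\<^sup>2 * ?Z" if h: "centered h" for h
  proof -
    have "?v h \<le> wmean (\<lambda>x. (real (card I))\<^sup>2 * 1)"
    proof (rule wmean_mono)
      show "(\<Sum>j\<in>I. h (x j))\<^sup>2 \<le> (real (card I))\<^sup>2 * 1" for x
      proof -
        have "\<bar>\<Sum>j\<in>I. h (x j)\<bar> \<le> (\<Sum>j\<in>I. 1)"
          using h by (intro order_trans[OF sum_abs] sum_mono) (simp add: centered_def)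
        then show ?thesis using power_mono[of "\<bar>\<Sum>j\<in>I. h (x j)\<bar>" "card I" 2] by simp
      qed
    qed (rule bounded_observable_power2[OF bounded_observable_sum[OF bounded_observable_centered[OF h]]] bounded_observable_const; assumption)+
    then show ?thesis unfolding wmean_cmult .
  qed
  then have bdd: "bdd_above V"
    unfolding V_def using wmean_1_pos by (intro bdd_aboveI2[where M="(real (card I))\<^sup>2"]) (simp add: divide_le_eq)
  have le: "?v h \<le> Sup V * ?Z" if "centered h" for h
    using cSup_upper[OF _ bdd, of "?v h / ?Z"] that wmean_1_pos by (auto simp: V_def divide_le_eq)
  have "Sup V \<le> card I + (Sup V + 1) / 2"
  proof (rule cSup_least)
    show "V \<noteq> {}" using f by (auto simp: V_def)
    show "v \<le> card I + (Sup V + 1) / 2" if "v \<in> V" for v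
      using that wmean_power2_sum_rec[OF le] wmean_1_pos by (auto simp: V_def divide_le_eq)
  qed
  then have "Sup V \<le> 2 * real (card I) + 1" by (simp add: field_simps)
  also have "\<dots> \<le> 3 * real (card I)" using card_I_gt by simp
  finally have "Sup V \<le> 3 * real (card I)" .
  then have "Sup V * ?Z \<le> 3 * real (card I) * ?Z" using wmean_1_pos by simp
  with le[OF f] show ?thesis by simp
qed

end

section \<open>Integrability of the Sobolev weight\<close>

text \<open>Outside [-1, 1] the integrand is at most \<open>\<bar>x\<bar> powr (- (2 * s))\<close>,
  which is integrable since \<open>2 * s > 1\<close>; on [-1, 1] it is at most 1. The negative
  half-line is handled by reflection.\<close>

lemma nn_integral_powr_weight_real:
  fixes s :: real
  assumes s: "s > 1 / 2"
  shows "(\<integral>\<^sup>+x. ennreal ((1 + x\<^sup>2) powr (- s)) \<partial>(lborel :: real measure)) < \<infinity>"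
proof -
  let ?f = "\<lambda>x::real. ennreal (x powr (- (2 * s)) * indicator {1..} x)"
  have "((\<lambda>x. x powr (- (2 * s))) has_integral -(1 powr (- (2 * s) + 1)) / (- (2 * s) + 1)) {1..}"
    using s by (intro has_integral_powr_to_inf) auto
  then have f: "integral\<^sup>N lborel ?f = ennreal (-(1 powr (- (2 * s) + 1)) / (- (2 * s) + 1))"
    using nn_integral_has_integral_lebesgue[where f="\<lambda>x. x powr (- (2 * s))" and \<Omega>="{1..}"]
    by (simp add: nn_integral_completion mult.commute)
  have refl: "(\<integral>\<^sup>+x. ?f (- x) \<partial>lborel) = integral\<^sup>N lborel ?f"
    using nn_integral_real_affine[of ?f "-1" 0] by simp
  have "(\<integral>\<^sup>+x. ennreal ((1 + x\<^sup>2) powr (- s)) \<partial>(lborel :: real measure))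
      \<le> (\<integral>\<^sup>+x. indicator {-1..1} x + (?f x + ?f (- x)) \<partial>lborel)"
  proof (rule nn_integral_mono)
    fix x :: real
    have 1: "(1 + x\<^sup>2) powr (- s) \<le> 1"
      using s powr_mono[of "- s" 0 "1 + x\<^sup>2"] by (simp add: add_nonneg_eq_0_iff)
    have 2: "(1 + x\<^sup>2) powr (- s) \<le> \<bar>x\<bar> powr (- (2 * s))" if "\<bar>x\<bar> \<ge> 1"
    proof -
      have "(1 + x\<^sup>2) powr (- s) \<le> (\<bar>x\<bar>\<^sup>2) powr (- s)"
        using that s by (intro powr_mono2') auto
      also have "\<bar>x\<bar>\<^sup>2 = \<bar>x\<bar> powr 2" using that by (subst powr_numeral) auto
      finally show ?thesis unfolding powr_powr by simp
    qed
    consider "\<bar>x\<bar> \<le> 1" | "x > 1" | "x < - 1" by linarith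
    then show "ennreal ((1 + x\<^sup>2) powr (- s)) \<le> indicator {-1..1} x + (?f x + ?f (- x))"
    proof cases
      case 1
      then show ?thesis using \<open>(1 + x\<^sup>2) powr (- s) \<le> 1\<close>
        by (auto simp: indicator_def abs_le_iff intro!: add_increasing2)
    qed (use 2 in \<open>auto simp: indicator_def intro!: ennreal_leI\<close>)
  qed
  also have "\<dots> = emeasure lborel {-1..1::real} + (integral\<^sup>N lborel ?f + integral\<^sup>N lborel ?f)"
    unfolding refl[symmetric] by (simp add: nn_integral_add refl)
  also have "\<dots> < \<infinity>" by (simp add: f)
  finally show ?thesis .
qed

text \<open>The weight is split into \<open>DIM('a)\<close> equal factors with exponent
  \<open>s = \<alpha> / DIM('a)\<close>. Replacing the norm in each factor by one coordinate only
  increases it, and the integral factorizes into one-dimensional integrals, finite exactly because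
  \<open>s > 1 / 2\<close>.\<close>

lemma nn_integral_powr_weight:
  fixes \<alpha> :: real
  assumes \<alpha>: "\<alpha> > real DIM('a::euclidean_space) / 2"
  shows "(\<integral>\<^sup>+\<xi>. ennreal ((1 + (norm \<xi>)\<^sup>2) powr (- \<alpha>)) \<partial>(lborel :: 'a measure)) < \<infinity>"
proof -
  define s where "s = \<alpha> / DIM('a)"
  have d: "0 < real DIM('a)" by simp
  have s: "s > 1 / 2" using \<alpha> d by (simp add: s_def field_simps)
  have "(\<integral>\<^sup>+\<xi>. ennreal ((1 + (norm \<xi>)\<^sup>2) powr (- \<alpha>)) \<partial>(lborel :: 'a measure))
      \<le> (\<integral>\<^sup>+\<xi>. (\<Prod>b\<in>Basis. ennreal ((1 + (\<xi> \<bullet> b)\<^sup>2) powr (- s))) \<partial>(lborel :: 'a measure))"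
  proof (rule nn_integral_mono)
    fix \<xi> :: 'a
    have "(1 + (norm \<xi>)\<^sup>2) powr (- \<alpha>) = (\<Prod>b\<in>(Basis :: 'a set). (1 + (norm \<xi>)\<^sup>2) powr (- s))"
      using d add_pos_nonneg[OF zero_less_one zero_le_power2[of "norm \<xi>"]]
      by (simp add: s_def powr_powr flip: powr_realpow)
    also have "\<dots> \<le> (\<Prod>b\<in>(Basis :: 'a set). (1 + (\<xi> \<bullet> b)\<^sup>2) powr (- s))"
    proof (intro prod_mono conjI powr_mono2')
      show "1 + (\<xi> \<bullet> b)\<^sup>2 \<le> 1 + (norm \<xi>)\<^sup>2" if "b \<in> Basis" for b
        using power_mono[OF Basis_le_norm[OF that, of \<xi>], of 2] by simp
      show "0 < 1 + (\<xi> \<bullet> b)\<^sup>2" for b by (simp add: add_pos_nonneg)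
    qed (use s in auto)
    finally show "ennreal ((1 + (norm \<xi>)\<^sup>2) powr (- \<alpha>)) \<le> (\<Prod>b\<in>Basis. ennreal ((1 + (\<xi> \<bullet> b)\<^sup>2) powr (- s)))"
      by (simp add: prod_ennreal ennreal_leI)
  qed
  also have "\<dots> = (\<Prod>b\<in>(Basis :: 'a set). \<integral>\<^sup>+x. ennreal ((1 + x\<^sup>2) powr (- s)) \<partial>lborel)"
    by (rule nn_integral_lborel_prod) auto
  also have "\<dots> < \<infinity>"
    using nn_integral_powr_weight_real[OF s] by (simp add: power_less_top_ennreal)
  finally show ?thesis .
qed

section \<open>Borel versions\<close>

lemma borel_version:
  fixes f :: "'a::euclidean_space \<Rightarrow> real"
  assumes "f \<in> borel_measurable lebesgue"
  obtains f' where "f' \<in> borel_measurable borel" "AE x in lborel. f x = f' x"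
  using completion_ex_borel_measurable_real[OF assms] by auto

text \<open>The predicate is arbitrary, so the reflection invariance of Lebesgue measure is applied
  to a Borel null set covering its exceptions.\<close>

lemma AE_lborel_uminus:
  assumes "AE x in lborel. P (x::'a::euclidean_space)"
  shows "AE x in lborel. P (- x)"
proof -
  obtain M where M: "{x. \<not> P x} \<subseteq> M" "emeasure lborel M = 0" "M \<in> sets borel"
    using assms by (auto elim!: AE_E)
  have *: "(lborel :: 'a measure) = distr lborel borel uminus"
    using lborel_affine[of "-1" "0 :: 'a"] by (simp add: density_1 fun_Compl_def)
  have "AE x in distr lborel borel uminus. (x::'a) \<notin> M"
    using M(2,3) unfolding *[symmetric] by (intro AE_not_in) (simp add: null_sets_def)
  then have "AE x in lborel. - (x::'a) \<notin> M"
    using M(3) by (subst (asm) AE_distr_iff) auto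
  then show ?thesis using M(1) by (auto elim!: AE_mp)
qed

lemma AE_lborel_translate:
  assumes "AE x in lborel. P (x::'a::euclidean_space)"
  shows "AE x in lborel. P (c + x)"
proof -
  obtain M where M: "{x. \<not> P x} \<subseteq> M" "emeasure lborel M = 0" "M \<in> sets borel"
    using assms by (auto elim!: AE_E)
  have "AE x in distr lborel borel ((+) c). x \<notin> M"
    using M(2,3) unfolding lborel_distr_plus by (intro AE_not_in) (simp add: null_sets_def)
  then have "AE x in lborel. c + x \<notin> M"
    using M(3) by (subst (asm) AE_distr_iff) auto
  then show ?thesis using M(1) by (auto elim!: AE_mp)
qed

lemma AE_lborel_reflect:
  assumes "AE x in lborel. P (x::'a::euclidean_space)"
  shows "AE y in lborel. P (x - y)"
  using AE_lborel_uminus[OF AE_lborel_translate[OF assms, of x]] by simp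

text \<open>Turns bounds and symmetry valid almost everywhere into ones valid everywhere: a Borel
  version is truncated at height \<open>B\<close> and then averaged with its reflection. Taking the
  maximum with 1 keeps \<open>B\<close> positive.\<close>

lemma bounded_symmetric_borel_version:
  fixes W :: "'a::euclidean_space \<Rightarrow> real"
  assumes "W \<in> L_infty" and sym: "AE x in lebesgue. W (- x) = W x"
  obtains W' B where "W' \<in> borel_measurable borel" "AE x in lborel. W x = W' x"
    "\<And>x. W' (- x) = W' x" "0 < B" "\<And>x. \<bar>W' x\<bar> \<le> B"
proof -
  obtain B0 where W: "W \<in> borel_measurable lebesgue" and B0: "AE x in lborel. \<bar>W x\<bar> \<le> B0"
    using assms(1) by (auto simp: L_infty_def AE_completion_iff)
  obtain V where V[measurable]: "V \<in> borel_measurable borel" and WV: "AE x in lborel. W x = V x"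
    using borel_version[OF W] .
  define B where "B = max B0 1"
  define T where "T x = max (- B) (min B (V x))" for x
  have T[measurable]: "T \<in> borel_measurable borel" unfolding T_def[abs_def] by measurable
  have B: "0 < B" by (simp add: B_def)
  have Tb: "\<bar>T x\<bar> \<le> B" for x using B by (auto simp: T_def)
  have WT: "AE x in lborel. W x = T x"
    using WV B0 by eventually_elim (auto simp: T_def B_def)
  define W' where "W' x = (T x + T (- x)) / 2" for x
  show ?thesis
  proof
    show "W' \<in> borel_measurable borel" unfolding W'_def[abs_def] by measurable
    have "AE x in lborel. W (- x) = W x" using sym by (simp add: AE_completion_iff)
    then show "AE x in lborel. W x = W' x"
      using WT AE_lborel_uminus[OF WT] by eventually_elim (simp add: W'_def)
    show "W' (- x) = W' x" for x by (simp add: W'_def)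
    show "\<bar>W' x\<bar> \<le> B" for x using Tb[of x] Tb[of "- x"] unfolding W'_def by (simp add: abs_le_iff field_simps)
  qed (rule B)
qed

section \<open>The self-consistent density\<close>

lemma integrable_bounded_mult:
  fixes f g :: "'b \<Rightarrow> real"
  assumes "integrable M f" "g \<in> borel_measurable M" "\<And>x. \<bar>g x\<bar> \<le> C"
  shows "integrable M (\<lambda>x. g x * f x)"
proof (rule Bochner_Integration.integrable_bound)
  show "integrable M (\<lambda>x. C * \<bar>f x\<bar>)" using assms(1) by simp
  have "0 \<le> C" using assms(3)[of undefined] by linarith
  then show "AE x in M. norm (g x * f x) \<le> norm (C * \<bar>f x\<bar>)"
    using assms(3) by (intro AE_I2) (auto simp: abs_mult intro: mult_right_mono)
qed (use assms in measurable)

lemma abs_integral_bounded_mult_le: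
  fixes f g :: "'b \<Rightarrow> real"
  assumes "integrable M f" "g \<in> borel_measurable M" "\<And>x. \<bar>g x\<bar> \<le> C"
  shows "\<bar>LINT x|M. g x * f x\<bar> \<le> C * (LINT x|M. \<bar>f x\<bar>)"
proof -
  have "\<bar>LINT x|M. g x * f x\<bar> \<le> (LINT x|M. \<bar>g x * f x\<bar>)" by (rule integral_abs_bound)
  also have "\<dots> \<le> (LINT x|M. C * \<bar>f x\<bar>)"
    using assms(1,3) integrable_abs[OF integrable_bounded_mult[OF assms]]
    by (intro integral_mono) (simp_all add: abs_mult mult_right_mono)
  finally show ?thesis by simp
qed

locale mean_field =
  fixes U W :: "'a::euclidean_space \<Rightarrow> real" and B \<beta> :: real
  assumes U_measurable [measurable]: "U \<in> borel_measurable borel"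
    and W_measurable [measurable]: "W \<in> borel_measurable borel"
    and W_bound: "\<And>x. \<bar>W x\<bar> \<le> B"
    and W_sym: "\<And>x. W (- x) = W x"
    and B_pos: "0 < B" and \<beta>_pos: "0 < \<beta>" and \<beta>_small: "64 * \<beta> * B \<le> 1"
    and exp_U: "integrable lborel (\<lambda>x. exp (- \<beta> * U x))"
begin

text \<open>The ball of potentials on which the fixed-point iteration runs; it contains every
  convolution of \<open>W\<close> with a probability density.\<close>

definition admissible :: "('a \<Rightarrow> real) \<Rightarrow> bool" where
  "admissible \<phi> \<longleftrightarrow> \<phi> \<in> borel_measurable borel \<and> (\<forall>x. \<bar>\<phi> x\<bar> \<le> B)"

definition partition :: "('a \<Rightarrow> real) \<Rightarrow> real" where
  "partition \<phi> = (LINT y|lborel. exp (- \<beta> * (U y + \<phi> y)))"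

definition gibbs_density :: "('a \<Rightarrow> real) \<Rightarrow> 'a \<Rightarrow> real" where
  "gibbs_density \<phi> y = exp (- \<beta> * (U y + \<phi> y)) / partition \<phi>"

definition convolve :: "('a \<Rightarrow> real) \<Rightarrow> 'a \<Rightarrow> real" where
  "convolve \<sigma> x = (LINT y|lborel. W (x - y) * \<sigma> y)"

lemma integrable_boltzmann:
  assumes "admissible \<phi>"
  shows "integrable lborel (\<lambda>y. exp (- \<beta> * (U y + \<phi> y)))"
proof -
  have "integrable lborel (\<lambda>y. exp (- \<beta> * \<phi> y) * exp (- \<beta> * U y))"
  proof (rule integrable_bounded_mult[OF exp_U])
    show "\<bar>exp (- \<beta> * \<phi> y)\<bar> \<le> exp (\<beta> * B)" for y
    proof -
      have "- \<phi> y \<le> B" using assms by (auto simp: admissible_def abs_le_iff)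
      from mult_left_mono[OF this, of \<beta>] show ?thesis using \<beta>_pos by simp
    qed
  qed (use assms in \<open>auto simp: admissible_def\<close>)
  then show ?thesis by (simp add: algebra_simps flip: exp_add)
qed

lemma partition_pos:
  assumes "admissible \<phi>"
  shows "0 < partition \<phi>"
proof -
  have "0 \<le> partition \<phi>" unfolding partition_def by (intro Bochner_Integration.integral_nonneg) simp
  moreover have "partition \<phi> \<noteq> 0"
  proof
    assume "partition \<phi> = 0"
    then have "AE y in lborel. exp (- \<beta> * (U y + \<phi> y)) = 0"
      unfolding partition_def using integrable_boltzmann[OF assms]
      by (subst (asm) integral_nonneg_eq_0_iff_AE) auto
    then have "AE y in (lborel :: 'a measure). False" by simp
    then have "emeasure lborel (UNIV :: 'a set) = 0" by (simp add: AE_iff_measurable[of UNIV])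
    then show False by simp
  qed
  ultimately show ?thesis by simp
qed

lemma gibbs_density_pos: "admissible \<phi> \<Longrightarrow> 0 < gibbs_density \<phi> y"
  by (simp add: gibbs_density_def partition_pos)

lemma measurable_gibbs_density: "admissible \<phi> \<Longrightarrow> gibbs_density \<phi> \<in> borel_measurable borel"
  unfolding gibbs_density_def[abs_def] by (auto simp: admissible_def)

lemma integrable_gibbs_density: "admissible \<phi> \<Longrightarrow> integrable lborel (gibbs_density \<phi>)"
  unfolding gibbs_density_def[abs_def] using integrable_boltzmann by simp

lemma integral_gibbs_density: "admissible \<phi> \<Longrightarrow> (LINT y|lborel. gibbs_density \<phi> y) = 1"
  using partition_pos[of \<phi>] unfolding gibbs_density_def[abs_def] integral_divide_zero partition_def[symmetric] by simp

lemma convolve_integrand: "integrable lborel \<sigma> \<Longrightarrow> integrable lborel (\<lambda>y. W (x - y) * \<sigma> y)"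
  by (intro integrable_bounded_mult[where C=B]) (auto simp: W_bound)

lemma abs_convolve_le:
  assumes "integrable lborel \<sigma>"
  shows "\<bar>convolve \<sigma> x\<bar> \<le> B * (LINT y|lborel. \<bar>\<sigma> y\<bar>)"
  unfolding convolve_def using assms by (intro abs_integral_bounded_mult_le) (auto simp: W_bound)

lemma measurable_convolve:
  assumes "integrable lborel \<sigma>"
  shows "convolve \<sigma> \<in> borel_measurable borel"
proof -
  have [measurable]: "\<sigma> \<in> borel_measurable borel" using assms by auto
  show ?thesis unfolding convolve_def[abs_def] by measurable
qed

lemma admissible_convolve:
  assumes "integrable lborel \<sigma>" "(LINT y|lborel. \<bar>\<sigma> y\<bar>) = 1"
  shows "admissible (convolve \<sigma>)"
  using measurable_convolve[OF assms(1)] abs_convolve_le[OF assms(1)] assms(2) by (simp add: admissible_def)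

lemma abs_gibbs_density: "admissible \<phi> \<Longrightarrow> \<bar>gibbs_density \<phi> y\<bar> = gibbs_density \<phi> y"
  using gibbs_density_pos by (simp add: less_imp_le)

section \<open>Contraction in the potential and its fixed point\<close>

lemma admissible_step: "admissible \<phi> \<Longrightarrow> admissible (convolve (gibbs_density \<phi>))"
  by (intro admissible_convolve) (auto simp: integrable_gibbs_density abs_gibbs_density integral_gibbs_density)

text \<open>A perturbation of the potential by \<delta> changes the Boltzmann factor and the
  partition function each by at most a factor \<open>exp (\<beta> * \<delta>)\<close>; the quotient
  collects both.\<close>

lemma gibbs_density_le:
  assumes \<phi>: "admissible \<phi>" and \<psi>: "admissible \<psi>" and le: "\<And>x. \<bar>\<phi> x - \<psi> x\<bar> \<le> \<delta>"
  shows "gibbs_density \<phi> y \<le> exp (2 * \<beta> * \<delta>) * gibbs_density \<psi> y"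
proof -
  have b: "exp (- \<beta> * (U y + \<phi> y)) \<le> exp (\<beta> * \<delta>) * exp (- \<beta> * (U y + \<psi> y))"
    if "\<And>x. \<bar>\<phi> x - \<psi> x\<bar> \<le> \<delta>" for \<phi> \<psi> y
  proof -
    have "\<psi> y - \<phi> y \<le> \<delta>" using that[of y] by linarith
    from mult_left_mono[OF this, of \<beta>] show ?thesis
      using \<beta>_pos by (simp add: algebra_simps flip: exp_add)
  qed
  have "partition \<psi> \<le> (LINT y|lborel. exp (\<beta> * \<delta>) * exp (- \<beta> * (U y + \<phi> y)))"
    unfolding partition_def using integrable_boltzmann \<phi> \<psi> le
    by (intro integral_mono b) (auto simp: abs_minus_commute)
  then have P: "partition \<psi> \<le> exp (\<beta> * \<delta>) * partition \<phi>" by (simp add: partition_def)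
  have "exp (- \<beta> * (U y + \<phi> y)) * partition \<psi>
      \<le> (exp (\<beta> * \<delta>) * exp (- \<beta> * (U y + \<psi> y))) * (exp (\<beta> * \<delta>) * partition \<phi>)"
    using partition_pos[OF \<psi>] by (intro mult_mono b le P) auto
  also have "\<dots> = exp (2 * \<beta> * \<delta>) * exp (- \<beta> * (U y + \<psi> y)) * partition \<phi>"
    by (simp add: algebra_simps flip: exp_add)
  finally show ?thesis
    using partition_pos[OF \<phi>] partition_pos[OF \<psi>] by (simp add: gibbs_density_def field_simps)
qed

text \<open>The relative change of the density is at most
  \<open>r = exp (2 * \<beta> * \<delta>) - 1\<close>, hence of order
  \<open>\<beta> * \<delta>\<close>, and integration against \<open>W\<close> costs a factor
  \<open>B\<close>. The restriction \<open>\<delta> \<le> 2 * B\<close>, the diameter of the ball,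
  keeps the exponent in the range where the exponential is linearized.\<close>

lemma convolve_gibbs_density_contraction:
  assumes \<phi>: "admissible \<phi>" and \<psi>: "admissible \<psi>" and le: "\<And>x. \<bar>\<phi> x - \<psi> x\<bar> \<le> \<delta>" and \<delta>: "\<delta> \<le> 2 * B"
  shows "\<bar>convolve (gibbs_density \<phi>) x - convolve (gibbs_density \<psi>) x\<bar> \<le> \<delta> / 2"
proof -
  have \<delta>0: "0 \<le> \<delta>" using le[of 0] by linarith
  define r where "r = exp (2 * \<beta> * \<delta>) - 1"
  have "2 * \<beta> * \<delta> \<le> 4 * (\<beta> * B)" using mult_left_mono[OF \<delta>, of "2 * \<beta>"] \<beta>_pos by simp
  moreover have "64 * (\<beta> * B) \<le> 1" "0 \<le> 2 * \<beta> * \<delta>" using \<delta>0 \<beta>_pos \<beta>_small by simp_all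
  ultimately have u: "\<bar>2 * \<beta> * \<delta>\<bar> \<le> 1" by linarith
  have r: "r \<le> 4 * \<beta> * \<delta>" "0 \<le> r"
    using abs_exp_minus_one_le[OF u] \<delta>0 \<beta>_pos by (auto simp: r_def)
  have g: "\<bar>gibbs_density \<phi> y - gibbs_density \<psi> y\<bar> \<le> r * (gibbs_density \<phi> y + gibbs_density \<psi> y)" for y
  proof -
    have "gibbs_density \<phi> y \<le> gibbs_density \<psi> y + r * gibbs_density \<psi> y" "gibbs_density \<psi> y \<le> gibbs_density \<phi> y + r * gibbs_density \<phi> y"
      using gibbs_density_le[OF \<phi> \<psi> le, of y] gibbs_density_le[OF \<psi> \<phi>, of \<delta> y] le
      by (auto simp: r_def algebra_simps abs_minus_commute)
    moreover have "0 \<le> r * gibbs_density \<psi> y" "0 \<le> r * gibbs_density \<phi> y"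
      using r gibbs_density_pos[OF \<psi>, of y] gibbs_density_pos[OF \<phi>, of y] by auto
    ultimately show ?thesis by (simp add: distrib_left abs_le_iff)
  qed
  have "convolve (gibbs_density \<phi>) x - convolve (gibbs_density \<psi>) x = (LINT y|lborel. W (x - y) * (gibbs_density \<phi> y - gibbs_density \<psi> y))"
    unfolding convolve_def using integrable_gibbs_density[OF \<phi>] integrable_gibbs_density[OF \<psi>]
    by (simp add: right_diff_distrib convolve_integrand)
  also have "\<bar>\<dots>\<bar> \<le> B * (LINT y|lborel. \<bar>gibbs_density \<phi> y - gibbs_density \<psi> y\<bar>)"
    using integrable_gibbs_density[OF \<phi>] integrable_gibbs_density[OF \<psi>]
    by (intro abs_integral_bounded_mult_le) (auto simp: W_bound)
  also have "\<dots> \<le> B * (LINT y|lborel. r * (gibbs_density \<phi> y + gibbs_density \<psi> y))"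
    using integrable_gibbs_density[OF \<phi>] integrable_gibbs_density[OF \<psi>] B_pos g
    by (intro mult_left_mono integral_mono) auto
  also have "\<dots> = 2 * B * r"
    using integrable_gibbs_density[OF \<phi>] integrable_gibbs_density[OF \<psi>] by (simp add: integral_gibbs_density \<phi> \<psi>)
  also have "\<dots> \<le> 2 * B * (4 * \<beta> * \<delta>)" using r B_pos by simp
  \<comment> \<open>Smallness of \<beta> gives the contraction factor 1/8; 1/2 is all that is used
    below.\<close>
  also have "\<dots> = 64 * \<beta> * B * \<delta> / 8" by simp
  also have "\<dots> \<le> \<delta> / 2"
    using mult_right_mono[OF \<beta>_small \<delta>0] \<delta>0 by linarith
  finally show ?thesis .
qed

text \<open>Banach iteration from the zero potential, carried out pointwise with explicit geometric
  rates that are uniform in \<open>x\<close>. The limit is Borel as a pointwise limit of Borel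
  functions.\<close>

lemma fixed_point_exists: "\<exists>\<phi>. admissible \<phi> \<and> convolve (gibbs_density \<phi>) = \<phi>"
proof -
  define f where "f n = ((\<lambda>\<phi>. convolve (gibbs_density \<phi>)) ^^ n) (\<lambda>_. 0)" for n
  have f_Suc: "f (Suc n) = convolve (gibbs_density (f n))" for n by (simp add: f_def)
  have ok: "admissible (f n)" for n
  proof (induction n)
    case 0
    show ?case using B_pos by (simp add: f_def admissible_def)
  qed (simp add: f_Suc admissible_step)
  have b: "\<bar>f n x\<bar> \<le> B" for n x using ok by (simp add: admissible_def)
  have pw: "2 * B * (1 / 2) ^ n \<le> 2 * B" for n
    using B_pos by (simp add: power_le_one)
  have step: "\<bar>f (Suc n) x - f n x\<bar> \<le> 2 * B * (1 / 2) ^ n" for n x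
  proof (induction n arbitrary: x)
    case 0
    show ?case using b[of "Suc 0" x] b[of 0 x] by simp
  next
    case (Suc n)
    have "\<bar>convolve (gibbs_density (f (Suc n))) x - convolve (gibbs_density (f n)) x\<bar> \<le> 2 * B * (1 / 2) ^ n / 2"
      by (rule convolve_gibbs_density_contraction[OF ok ok Suc pw])
    then show ?case by (simp add: f_Suc)
  qed
  \<comment> \<open>The factor \<open>1 - (1 / 2) ^ m\<close> is the exact partial sum of the
    geometric series; the weaker bound without it would not pass through the induction.\<close>
  have tail: "\<bar>f (n + m) x - f n x\<bar> \<le> 4 * B * (1 / 2) ^ n * (1 - (1 / 2) ^ m)" for n m x
  proof (induction m)
    case (Suc m)
    have "\<bar>f (n + Suc m) x - f n x\<bar> \<le> \<bar>f (Suc (n + m)) x - f (n + m) x\<bar> + \<bar>f (n + m) x - f n x\<bar>"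
      by simp
    also have "\<dots> \<le> 2 * B * (1 / 2) ^ (n + m) + 4 * B * (1 / 2) ^ n * (1 - (1 / 2) ^ m)"
      by (intro add_mono step Suc)
    also have "\<dots> = 4 * B * (1 / 2) ^ n * (1 - (1 / 2) ^ Suc m)"
      by (simp add: power_add algebra_simps)
    finally show ?case .
  qed simp
  have tail': "\<bar>f (n + m) x - f n x\<bar> \<le> 4 * B * (1 / 2) ^ n" for n m x
  proof -
    have "4 * B * (1 / 2) ^ n * (1 - (1 / 2) ^ m) \<le> 4 * B * (1 / 2) ^ n * 1"
      using B_pos by (intro mult_left_mono) auto
    with tail[of n m x] show ?thesis by simp
  qed
  have lim0: "(\<lambda>n. 4 * B * (1 / 2) ^ n) \<longlonglongrightarrow> 0"
    by (rule tendsto_mult_right_zero) (simp add: LIMSEQ_realpow_zero)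
  have "Cauchy (\<lambda>n. f n x)" for x
  proof (rule metric_CauchyI)
    fix e :: real assume "0 < e"
    then have "0 < e / 2" by simp
    from order_tendstoD(2)[OF lim0 this] obtain n where n: "4 * B * (1 / 2) ^ n < e / 2"
      by (auto simp: eventually_sequentially)
    have "dist (f k x) (f l x) < e" if "k \<ge> n" "l \<ge> n" for k l
    proof -
      have "\<bar>f k x - f n x\<bar> < e / 2" "\<bar>f l x - f n x\<bar> < e / 2"
        using tail'[of n "k - n" x] tail'[of n "l - n" x] n that by auto
      then show ?thesis unfolding dist_real_def by linarith
    qed
    then show "\<exists>M. \<forall>m\<ge>M. \<forall>n\<ge>M. dist (f m x) (f n x) < e" by blast
  qed
  then have "\<forall>x. \<exists>l. (\<lambda>n. f n x) \<longlonglongrightarrow> l" by (simp add: Cauchy_convergent_iff convergent_def)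
  then obtain \<phi> where lim: "\<And>x. (\<lambda>n. f n x) \<longlonglongrightarrow> \<phi> x" by metis
  have \<phi>: "admissible \<phi>"
    unfolding admissible_def
  proof
    show "\<phi> \<in> borel_measurable borel"
    proof (rule borel_measurable_LIMSEQ_real)
      show "f i \<in> borel_measurable borel" for i using ok by (simp add: admissible_def)
    qed (rule lim)
    show "\<forall>x. \<bar>\<phi> x\<bar> \<le> B"
    proof
      show "\<bar>\<phi> x\<bar> \<le> B" for x
        by (rule LIMSEQ_le_const2[OF tendsto_rabs[OF lim]]) (use b in auto)
    qed
  qed
  have unif: "\<bar>\<phi> x - f n x\<bar> \<le> 4 * B * (1 / 2) ^ n" for n x
  proof (rule LIMSEQ_le_const2)
    show "(\<lambda>m. \<bar>f (m + n) x - f n x\<bar>) \<longlonglongrightarrow> \<bar>\<phi> x - f n x\<bar>"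
      by (intro tendsto_intros LIMSEQ_ignore_initial_segment lim)
    show "\<exists>M. \<forall>m\<ge>M. \<bar>f (m + n) x - f n x\<bar> \<le> 4 * B * (1 / 2) ^ n"
      using tail'[of n _ x] by (auto simp: add.commute)
  qed
  have "convolve (gibbs_density \<phi>) x = \<phi> x" for x
  proof -
    \<comment> \<open>Continuity of the iteration map at \<phi>, read off from the contraction
      estimate. The index is shifted so that the uniform error of \<open>f (Suc n)\<close> is at
      most \<open>2 * B\<close>, as the estimate demands.\<close>
    have "(\<lambda>n. f (Suc (Suc n)) x) \<longlonglongrightarrow> convolve (gibbs_density \<phi>) x"
    proof (rule LIM_zero_cancel, rule Lim_null_comparison[OF _ lim0], rule always_eventually, rule allI)
      fix n
      have "\<bar>\<phi> x - f (Suc n) x\<bar> \<le> 2 * B * (1 / 2) ^ n" for x using unif[of x "Suc n"] by simp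
      then have "\<bar>f (Suc n) x - \<phi> x\<bar> \<le> 2 * B * (1 / 2) ^ n" for x by (simp add: abs_minus_commute)
      from convolve_gibbs_density_contraction[OF ok \<phi> this pw]
      have "\<bar>f (Suc (Suc n)) x - convolve (gibbs_density \<phi>) x\<bar> \<le> 2 * B * (1 / 2) ^ n / 2" by (simp add: f_Suc)
      also have "\<dots> \<le> 4 * B * (1 / 2) ^ n" using B_pos by simp
      finally show "norm (f (Suc (Suc n)) x - convolve (gibbs_density \<phi>) x) \<le> 4 * B * (1 / 2) ^ n" by simp
    qed
    moreover have "(\<lambda>n. f (Suc (Suc n)) x) \<longlonglongrightarrow> \<phi> x"
      by (rule LIMSEQ_Suc[OF LIMSEQ_Suc[OF lim]])
    ultimately show ?thesis by (rule LIMSEQ_unique)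
  qed
  with \<phi> show ?thesis by blast
qed

end

section \<open>The minimizer of the free energy\<close>

lemma ext_integral_integrable:
  assumes "integrable M g"
  shows "ext_integral M g = ereal (LINT x|M. g x)"
proof -
  obtain r q where "0 \<le> r" "0 \<le> q" and rq: "(\<integral>\<^sup>+x. ennreal (g x) \<partial>M) = ennreal r"
    "(\<integral>\<^sup>+x. ennreal (- g x) \<partial>M) = ennreal q" "(LINT x|M. g x) = r - q"
    using integrableE[OF assms] by metis
  then show ?thesis by (simp add: ext_integral_def)
qed

text \<open>\<open>p\<close> is bounded by the positive part of \<open>p + q\<close> plus
  \<open>\<bar>q\<bar>\<close>, so that positive part has infinite integral, while the negative part
  is bounded by \<open>\<bar>q\<bar>\<close> and has a finite one.\<close>

lemma ext_integral_not_integrable: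
  assumes [measurable]: "p \<in> borel_measurable M" and p: "\<And>x. 0 \<le> p x" and q: "integrable M q"
    and "\<not> integrable M p"
  shows "ext_integral M (\<lambda>x. p x + q x) = \<infinity>"
proof -
  have [measurable]: "q \<in> borel_measurable M" using q by auto
  have qfin: "(\<integral>\<^sup>+x. ennreal \<bar>q x\<bar> \<partial>M) < \<infinity>"
    using q by (simp add: integrable_iff_bounded)
  have "\<infinity> = (\<integral>\<^sup>+x. ennreal (p x) \<partial>M)"
    using assms(4) p by (auto simp: integrable_iff_bounded less_top[symmetric])
  also have "\<dots> \<le> (\<integral>\<^sup>+x. ennreal (p x + q x) + ennreal \<bar>q x\<bar> \<partial>M)"
  proof (rule nn_integral_mono)
    show "ennreal (p x) \<le> ennreal (p x + q x) + ennreal \<bar>q x\<bar>" for x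
    proof (cases "0 \<le> p x + q x")
      case True
      then show ?thesis by (simp flip: ennreal_plus)
    next
      case False
      then have "p x \<le> \<bar>q x\<bar>" by linarith
      then show ?thesis by (intro add_increasing ennreal_leI) auto
    qed
  qed
  also have "\<dots> = (\<integral>\<^sup>+x. ennreal (p x + q x) \<partial>M) + (\<integral>\<^sup>+x. ennreal \<bar>q x\<bar> \<partial>M)"
    by (rule nn_integral_add) auto
  finally have pos: "(\<integral>\<^sup>+x. ennreal (p x + q x) \<partial>M) = \<infinity>"
    using qfin by (auto simp: top_unique ennreal_add_eq_top)
  have "(\<integral>\<^sup>+x. ennreal (- (p x + q x)) \<partial>M) \<le> (\<integral>\<^sup>+x. ennreal \<bar>q x\<bar> \<partial>M)"
    using p by (intro nn_integral_mono ennreal_leI) (smt (verit, best))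
  then have "(\<integral>\<^sup>+x. ennreal (- (p x + q x)) \<partial>M) < \<infinity>" using qfin by (rule le_less_trans)
  then have "enn2ereal (\<integral>\<^sup>+x. ennreal (- (p x + q x)) \<partial>M) \<noteq> \<infinity>"
    by (metis enn2ereal_eq_top_iff infinity_ennreal_def less_irrefl)
  then show ?thesis unfolding ext_integral_def pos by simp
qed

text \<open>Pointwise form of the bound of the squared Hellinger distance by the relative entropy.
  It is the inequality \<open>ln y \<le> y - 1\<close> at \<open>y = sqrt (r / s)\<close>.\<close>

lemma relative_entropy_density_ge:
  fixes s r :: real
  assumes "0 \<le> s" "0 < r"
  shows "(sqrt s - sqrt r)\<^sup>2 \<le> s * ln (s / r) - s + r"
proof (cases "s = 0")
  case False
  with assms have s: "0 < s" by simp
  have "ln (r / s) \<le> 2 * (sqrt (r / s) - 1)"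
    using ln_le_minus_one[of "sqrt (r / s)"] assms s by (simp add: ln_sqrt)
  then have "s * ln (r / s) \<le> s * (2 * (sqrt (r / s) - 1))"
    using assms by (intro mult_left_mono)
  also have "s * sqrt (r / s) = sqrt s * sqrt r"
    using s assms by (simp add: real_sqrt_divide field_simps)
  then have "s * (2 * (sqrt (r / s) - 1)) = 2 * (sqrt s * sqrt r) - 2 * s" by (simp add: algebra_simps)
  finally have "s * ln (r / s) \<le> 2 * (sqrt s * sqrt r) - 2 * s" .
  moreover have "ln (r / s) = - ln (s / r)" using s assms by (simp add: ln_div)
  ultimately show ?thesis using assms by (simp add: power2_diff algebra_simps)
qed (use assms in simp)

text \<open>Cauchy--Schwarz from its linearized form; the optimal \<open>t\<close> would be \<open>2 / sqrt h\<close>, but \<open>4 / L\<close> avoids \<open>h = 0\<close>.\<close>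

lemma square_le_if_linear_bounds:
  fixes L h :: real
  assumes "\<And>t. 0 < t \<Longrightarrow> L \<le> t / 2 * h + 2 / t" "0 \<le> L" "0 \<le> h"
  shows "L\<^sup>2 \<le> 4 * h"
proof (cases "L = 0")
  case False
  with assms have L: "0 < L" by simp
  then have "L \<le> 4 / L / 2 * h + 2 / (4 / L)" by (intro assms) simp
  with L show ?thesis by (simp add: field_simps power2_eq_square)
qed (use assms in simp)

text \<open>Factor \<open>s - r\<close> as a difference of squares of the roots and apply the
  arithmetic-geometric mean inequality with weight \<open>t\<close>.\<close>

lemma abs_diff_le_sqrt_diff:
  fixes s r t :: real
  assumes "0 \<le> s" "0 \<le> r" "0 < t"
  shows "\<bar>s - r\<bar> \<le> t / 2 * (sqrt s - sqrt r)\<^sup>2 + 1 / t * (s + r)"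
proof -
  define a b where "a = sqrt s" and "b = sqrt r"
  have ab: "0 \<le> a" "0 \<le> b" "s = a\<^sup>2" "r = b\<^sup>2" using assms by (auto simp: a_def b_def)
  have "s - r = (a - b) * (a + b)" by (simp add: ab power2_eq_square algebra_simps)
  then have eq: "\<bar>s - r\<bar> = \<bar>a - b\<bar> * (a + b)" using ab by (simp add: abs_mult)
  have "(a + b)\<^sup>2 \<le> 2 * (s + r)"
    using sum_squares_bound[of a b] ab by (simp add: power2_sum)
  moreover have "2 * (\<bar>a - b\<bar> * t) * (a + b) \<le> (\<bar>a - b\<bar> * t)\<^sup>2 + (a + b)\<^sup>2"
    by (rule sum_squares_bound)
  ultimately have "2 * t * \<bar>s - r\<bar> \<le> t\<^sup>2 * (a - b)\<^sup>2 + 2 * (s + r)"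
    by (simp add: eq power_mult_distrib mult_ac)
  then have "2 * t * \<bar>s - r\<bar> / (2 * t) \<le> (t\<^sup>2 * (a - b)\<^sup>2 + 2 * (s + r)) / (2 * t)"
    using assms by (intro divide_right_mono) auto
  also have "\<dots> = t / 2 * (a - b)\<^sup>2 + 1 / t * (s + r)"
    using assms by (simp add: add_divide_distrib power2_eq_square[of t])
  finally show ?thesis using assms by (simp add: a_def b_def)
qed

text \<open>The squared total variation norm is controlled by the Hellinger integral: the pointwise
  bound is integrated for every \<open>t\<close>, where both masses being 1 gives the term
  \<open>2 / t\<close>.\<close>

lemma integral_abs_diff_le_hellinger:
  fixes s r :: "'b \<Rightarrow> real"
  assumes s: "integrable M s" "\<And>x. 0 \<le> s x" "(LINT x|M. s x) = 1"
    and r: "integrable M r" "\<And>x. 0 \<le> r x" "(LINT x|M. r x) = 1"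
    and h: "integrable M (\<lambda>x. (sqrt (s x) - sqrt (r x))\<^sup>2)"
  shows "(LINT x|M. \<bar>s x - r x\<bar>)\<^sup>2 \<le> 4 * (LINT x|M. (sqrt (s x) - sqrt (r x))\<^sup>2)"
proof (rule square_le_if_linear_bounds)
  fix t :: real assume t: "0 < t"
  have "(LINT x|M. \<bar>s x - r x\<bar>)
      \<le> (LINT x|M. t / 2 * (sqrt (s x) - sqrt (r x))\<^sup>2 + 1 / t * (s x + r x))"
  proof (rule integral_mono)
    show "integrable M (\<lambda>x. t / 2 * (sqrt (s x) - sqrt (r x))\<^sup>2 + 1 / t * (s x + r x))"
      using s r h by simp
    show "\<bar>s x - r x\<bar> \<le> t / 2 * (sqrt (s x) - sqrt (r x))\<^sup>2 + 1 / t * (s x + r x)" for x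
      using s r t by (intro abs_diff_le_sqrt_diff)
  qed (use s r in simp)
  also have "\<dots> = t / 2 * (LINT x|M. (sqrt (s x) - sqrt (r x))\<^sup>2) + 2 / t"
    using s r h by simp
  finally show "(LINT x|M. \<bar>s x - r x\<bar>) \<le> t / 2 * (LINT x|M. (sqrt (s x) - sqrt (r x))\<^sup>2) + 2 / t" .
qed simp_all

section \<open>Excess free energy over the self-consistent density\<close>

context mean_field
begin

text \<open>The free energy for Borel data; \<open>free_energy_eq\<close> identifies it with
  \<open>free_energy\<close>.\<close>

definition energy_functional :: "('a \<Rightarrow> real) \<Rightarrow> ereal" where
  "energy_functional \<sigma> = ext_integral lborel (\<lambda>x. U x * \<sigma> x + 1 / \<beta> * (\<sigma> x * ln (\<sigma> x)))
     + ereal (1 / 2 * (LINT x|lborel. \<sigma> x * convolve \<sigma> x))"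

definition prob_density :: "('a \<Rightarrow> real) \<Rightarrow> bool" where
  "prob_density \<sigma> \<longleftrightarrow> (\<forall>x. 0 \<le> \<sigma> x) \<and> integrable lborel \<sigma> \<and> (LINT x|lborel. \<sigma> x) = 1"

lemma prob_density_gibbs_density: "admissible \<phi> \<Longrightarrow> prob_density (gibbs_density \<phi>)"
  by (simp add: prob_density_def gibbs_density_pos less_imp_le integrable_gibbs_density integral_gibbs_density)

lemma admissible_prob_density: "prob_density \<sigma> \<Longrightarrow> admissible (convolve \<sigma>)"
  by (intro admissible_convolve) (auto simp: prob_density_def)

lemma integrable_mult_convolve:
  assumes "admissible \<phi>" "integrable lborel \<sigma>"
  shows "integrable lborel (\<lambda>x. \<sigma> x * \<phi> x)"
  using integrable_bounded_mult[OF assms(2), of \<phi> B] assms(1) by (simp add: admissible_def mult.commute)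

text \<open>Fubini together with the symmetry of \<open>W\<close>.\<close>

lemma convolve_adjoint:
  assumes \<sigma>: "integrable lborel \<sigma>" and \<tau>: "integrable lborel \<tau>"
  shows "(LINT x|lborel. \<sigma> x * convolve \<tau> x) = (LINT x|lborel. \<tau> x * convolve \<sigma> x)"
proof -
  have [measurable]: "\<sigma> \<in> borel_measurable borel" "\<tau> \<in> borel_measurable borel"
    using \<sigma> \<tau> by auto
  have "integrable (lborel \<Otimes>\<^sub>M lborel) (\<lambda>(x, y). W (x - y) * (\<sigma> x * \<tau> y))"
    unfolding case_prod_beta
  proof (rule integrable_bounded_mult)
    show "integrable (lborel \<Otimes>\<^sub>M lborel) (\<lambda>p. \<sigma> (fst p) * \<tau> (snd p))"
    proof (rule lborel_pair.Fubini_integrable)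
      show "AE x in lborel. integrable lborel (\<lambda>y. \<sigma> (fst (x, y)) * \<tau> (snd (x, y)))"
        using \<tau> by simp
      show "integrable lborel (\<lambda>x. LINT y|lborel. norm (\<sigma> (fst (x, y)) * \<tau> (snd (x, y))))"
        using \<sigma> by (simp add: abs_mult)
    qed measurable
    show "\<bar>W (fst p - snd p)\<bar> \<le> B" for p by (rule W_bound)
  qed measurable
  from lborel_pair.Fubini_integral[OF this]
  have "(LINT y|lborel. LINT x|lborel. W (x - y) * (\<sigma> x * \<tau> y)) =
      (LINT x|lborel. LINT y|lborel. W (x - y) * (\<sigma> x * \<tau> y))" .
  moreover have "W (x - y) = W (y - x)" for x y using W_sym[of "y - x"] by simp
  then have "(LINT y|lborel. LINT x|lborel. W (x - y) * (\<sigma> x * \<tau> y)) = (LINT y|lborel. \<tau> y * convolve \<sigma> y)"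
    by (simp add: convolve_def mult_ac flip: integral_mult_right_zero)
  moreover have "(LINT x|lborel. LINT y|lborel. W (x - y) * (\<sigma> x * \<tau> y)) = (LINT x|lborel. \<sigma> x * convolve \<tau> x)"
    by (simp add: convolve_def mult_ac flip: integral_mult_right_zero)
  ultimately show ?thesis by simp
qed

text \<open>The integrand of the relative entropy with respect to
  \<open>gibbs_density \<phi>\<close>. The two added terms cancel upon integration and make it
  nonnegative at every point.\<close>

definition entropy_density :: "('a \<Rightarrow> real) \<Rightarrow> ('a \<Rightarrow> real) \<Rightarrow> 'a \<Rightarrow> real" where
  "entropy_density \<phi> \<sigma> x = \<sigma> x * ln (\<sigma> x / gibbs_density \<phi> x) - \<sigma> x + gibbs_density \<phi> x"

text \<open>The logarithm of \<open>gibbs_density \<phi>\<close> is affine in \<open>U\<close>, so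
  \<open>U\<close> can be eliminated in favor of the relative entropy. The integrand becomes
  \<open>p + q\<close> with \<open>p\<close> nonnegative and \<open>q\<close> integrable, and only
  the integrability of \<open>p\<close> decides whether the value is finite.\<close>

lemma energy_functional_eq:
  assumes \<phi>: "admissible \<phi>" and \<sigma>: "prob_density \<sigma>"
  shows "energy_functional \<sigma> = (if integrable lborel (entropy_density \<phi> \<sigma>) then
      ereal (1 / \<beta> * (LINT x|lborel. entropy_density \<phi> \<sigma> x) - (LINT x|lborel. \<sigma> x * \<phi> x) - ln (partition \<phi>) / \<beta>
        + 1 / 2 * (LINT x|lborel. \<sigma> x * convolve \<sigma> x)) else \<infinity>)"
proof -
  have s: "\<And>x. 0 \<le> \<sigma> x" "integrable lborel \<sigma>" "(LINT x|lborel. \<sigma> x) = 1" 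
    using \<sigma> by (auto simp: prob_density_def)
  then have [measurable]: "\<sigma> \<in> borel_measurable borel" by auto
  note measurable_gibbs_density[OF \<phi>, measurable]
  define p where "p x = 1 / \<beta> * entropy_density \<phi> \<sigma> x" for x
  define q where "q x = 1 / \<beta> * (\<sigma> x - gibbs_density \<phi> x) - \<sigma> x * \<phi> x - ln (partition \<phi>) / \<beta> * \<sigma> x" for x
  have pq: "U x * \<sigma> x + 1 / \<beta> * (\<sigma> x * ln (\<sigma> x)) = p x + q x" for x
  proof (cases "\<sigma> x = 0")
    case False
    then have "0 < \<sigma> x" using s(1)[of x] by simp
    have "ln (gibbs_density \<phi> x) = - \<beta> * (U x + \<phi> x) - ln (partition \<phi>)"
      using partition_pos[OF \<phi>] by (simp add: gibbs_density_def ln_div)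
    then have "ln (\<sigma> x / gibbs_density \<phi> x) = ln (\<sigma> x) + \<beta> * (U x + \<phi> x) + ln (partition \<phi>)"
      using \<open>0 < \<sigma> x\<close> gibbs_density_pos[OF \<phi>, of x] by (simp add: ln_div)
    then show ?thesis
      using \<beta>_pos unfolding p_def q_def entropy_density_def by (simp add: field_simps)
  qed (simp add: p_def q_def entropy_density_def)
  have p_meas: "p \<in> borel_measurable lborel" unfolding p_def[abs_def] entropy_density_def by measurable
  have p0: "0 \<le> p x" for x
    using relative_entropy_density_ge[OF s(1) gibbs_density_pos[OF \<phi>], of x x] \<beta>_pos
    by (simp add: p_def entropy_density_def order_trans[OF zero_le_power2])
  have q_int: "integrable lborel q"
    unfolding q_def using s \<phi> by (intro Bochner_Integration.integrable_diff integrable_mult_right integrable_gibbs_density integrable_mult_convolve) auto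
  have q_val: "(LINT x|lborel. q x) = - (LINT x|lborel. \<sigma> x * \<phi> x) - ln (partition \<phi>) / \<beta>"
    unfolding q_def using s \<phi> integrable_gibbs_density[OF \<phi>] integrable_mult_convolve[OF \<phi> s(2)]
    by (simp add: integral_gibbs_density)
  have p_int: "integrable lborel p \<longleftrightarrow> integrable lborel (entropy_density \<phi> \<sigma>)"
  proof
    assume "integrable lborel p"
    then have "integrable lborel (\<lambda>x. \<beta> * p x)" by simp
    then show "integrable lborel (entropy_density \<phi> \<sigma>)" using \<beta>_pos by (simp add: p_def)
  qed (simp add: p_def[abs_def])
  show ?thesis
  proof (cases "integrable lborel (entropy_density \<phi> \<sigma>)")
    case True
    then have "ext_integral lborel (\<lambda>x. p x + q x) = ereal (LINT x|lborel. p x + q x)"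
      using q_int p_int by (intro ext_integral_integrable) auto
    also have "(LINT x|lborel. p x + q x) = 1 / \<beta> * (LINT x|lborel. entropy_density \<phi> \<sigma> x)
        - (LINT x|lborel. \<sigma> x * \<phi> x) - ln (partition \<phi>) / \<beta>"
      using True q_int p_int by (simp add: q_val) (simp add: p_def[abs_def])
    finally show ?thesis unfolding energy_functional_def pq using True by simp
  next
    case False
    then show ?thesis
      unfolding energy_functional_def pq using ext_integral_not_integrable[OF p_meas p0 q_int] p_int by simp
  qed
qed

text \<open>At a fixed point the first-order terms cancel, leaving the relative entropy over \<beta>
  plus half the interaction energy of the difference \<eta>. The entropy is at least the Hellinger
  integral; half the interaction is at least \<open>- B / 2\<close> times the squared L1 norm of
  \<eta>, hence at least \<open>- 2 * B\<close> times the Hellinger integral.\<close>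

lemma energy_functional_gap:
  assumes \<phi>: "admissible \<phi>" and fixed: "convolve (gibbs_density \<phi>) = \<phi>" and \<sigma>: "prob_density \<sigma>"
  shows "integrable lborel (\<lambda>x. (sqrt (\<sigma> x) - sqrt (gibbs_density \<phi> x))\<^sup>2)" (is "integrable _ ?h")
    and "energy_functional (gibbs_density \<phi>) + ereal ((1 / \<beta> - 2 * B) * (LINT x|lborel. (sqrt (\<sigma> x) - sqrt (gibbs_density \<phi> x))\<^sup>2))
      \<le> energy_functional \<sigma>"
proof -
  let ?\<rho> = "gibbs_density \<phi>"
  have s: "\<And>x. 0 \<le> \<sigma> x" "integrable lborel \<sigma>" "(LINT x|lborel. \<sigma> x) = 1" 
    using \<sigma> by (auto simp: prob_density_def)
  then have [measurable]: "\<sigma> \<in> borel_measurable borel" by auto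
  note measurable_gibbs_density[OF \<phi>, measurable]
  have r: "\<And>x. 0 \<le> ?\<rho> x" "integrable lborel ?\<rho>" "(LINT x|lborel. ?\<rho> x) = 1" 
    using prob_density_gibbs_density[OF \<phi>] by (auto simp: prob_density_def)
  show h: "integrable lborel ?h"
  proof (rule Bochner_Integration.integrable_bound)
    show "integrable lborel (\<lambda>x. \<sigma> x + ?\<rho> x)" using s r by simp
    have "?h x \<le> \<sigma> x + ?\<rho> x" for x
      using s(1) r(1) by (simp add: power2_diff)
    then show "AE x in lborel. norm (?h x) \<le> norm (\<sigma> x + ?\<rho> x)"
      using s(1) r(1) by (intro AE_I2) simp
  qed measurable
  define e where "e = - (LINT x|lborel. ?\<rho> x * \<phi> x) - ln (partition \<phi>) / \<beta> + 1 / 2 * (LINT x|lborel. ?\<rho> x * \<phi> x)"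
  have "entropy_density \<phi> ?\<rho> = (\<lambda>_. 0)"
    using gibbs_density_pos[OF \<phi>] by (auto simp: entropy_density_def fun_eq_iff less_imp_neq[symmetric])
  then have e: "energy_functional ?\<rho> = ereal e"
    using energy_functional_eq[OF \<phi> prob_density_gibbs_density[OF \<phi>]] by (simp add: fixed e_def)
  show "energy_functional ?\<rho> + ereal ((1 / \<beta> - 2 * B) * (LINT x|lborel. ?h x)) \<le> energy_functional \<sigma>"
  proof (cases "integrable lborel (entropy_density \<phi> \<sigma>)")
    case True
    have "?h x \<le> entropy_density \<phi> \<sigma> x" for x
      unfolding entropy_density_def by (rule relative_entropy_density_ge[OF s(1) gibbs_density_pos[OF \<phi>]])
    then have "(LINT x|lborel. ?h x) \<le> (LINT x|lborel. entropy_density \<phi> \<sigma> x)"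
      using True h by (intro integral_mono)
    then have P: "1 / \<beta> * (LINT x|lborel. ?h x) \<le> 1 / \<beta> * (LINT x|lborel. entropy_density \<phi> \<sigma> x)"
      using \<beta>_pos by (intro mult_left_mono) auto
    define \<eta> where "\<eta> x = \<sigma> x - ?\<rho> x" for x
    have \<eta>: "integrable lborel \<eta>" unfolding \<eta>_def using s r by simp
    have cv: "convolve \<eta> x = convolve \<sigma> x - \<phi> x" for x
    proof -
      have "convolve \<eta> x = convolve \<sigma> x - convolve ?\<rho> x"
        unfolding convolve_def \<eta>_def using convolve_integrand[OF s(2)] convolve_integrand[OF r(2)]
        by (simp add: right_diff_distrib)
      then show ?thesis by (simp add: fixed)
    qed
    have ints: "integrable lborel (\<lambda>x. \<sigma> x * convolve \<sigma> x)" "integrable lborel (\<lambda>x. \<sigma> x * \<phi> x)"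
      "integrable lborel (\<lambda>x. ?\<rho> x * convolve \<sigma> x)" "integrable lborel (\<lambda>x. ?\<rho> x * \<phi> x)"
      using \<phi> admissible_prob_density[OF \<sigma>] s r by (auto intro: integrable_mult_convolve)
    have "(LINT x|lborel. \<eta> x * convolve \<eta> x) = (LINT x|lborel. \<sigma> x * convolve \<sigma> x)
        - (LINT x|lborel. \<sigma> x * \<phi> x) - (LINT x|lborel. ?\<rho> x * convolve \<sigma> x) + (LINT x|lborel. ?\<rho> x * \<phi> x)"
      unfolding cv \<eta>_def using ints by (simp add: algebra_simps)
    \<comment> \<open>Both cross terms agree: symmetry moves the convolution onto the Gibbs density,
      where the fixed-point equation turns it into \<phi>.\<close>
    also have "(LINT x|lborel. ?\<rho> x * convolve \<sigma> x) = (LINT x|lborel. \<sigma> x * \<phi> x)"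
      using convolve_adjoint[OF r(2) s(2)] by (simp add: fixed)
    finally have quad: "(LINT x|lborel. \<eta> x * convolve \<eta> x) = (LINT x|lborel. \<sigma> x * convolve \<sigma> x)
        - 2 * (LINT x|lborel. \<sigma> x * \<phi> x) + (LINT x|lborel. ?\<rho> x * \<phi> x)" by simp
    define L where "L = (LINT x|lborel. \<bar>\<eta> x\<bar>)"
    have "\<bar>LINT x|lborel. convolve \<eta> x * \<eta> x\<bar> \<le> (B * L) * (LINT x|lborel. \<bar>\<eta> x\<bar>)"
      using measurable_convolve[OF \<eta>] abs_convolve_le[OF \<eta>]
      by (intro abs_integral_bounded_mult_le \<eta>) (auto simp: L_def)
    also have "\<dots> = B * L\<^sup>2" by (simp add: L_def power2_eq_square)
    also have "\<dots> \<le> B * (4 * (LINT x|lborel. ?h x))"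
      using B_pos integral_abs_diff_le_hellinger[OF s(2,1,3) r(2,1,3) h]
      by (intro mult_left_mono) (auto simp: L_def \<eta>_def)
    finally have "- (4 * B * (LINT x|lborel. ?h x)) \<le> (LINT x|lborel. \<eta> x * convolve \<eta> x)"
      by (simp add: mult.commute abs_le_iff)
    with P have "e + (1 / \<beta> - 2 * B) * (LINT x|lborel. ?h x)
        \<le> 1 / \<beta> * (LINT x|lborel. entropy_density \<phi> \<sigma> x) - (LINT x|lborel. \<sigma> x * \<phi> x) - ln (partition \<phi>) / \<beta>
        + 1 / 2 * (LINT x|lborel. \<sigma> x * convolve \<sigma> x)"
      unfolding quad e_def left_diff_distrib by linarith
    then show ?thesis using True unfolding e energy_functional_eq[OF \<phi> \<sigma>] by simp
  next
    \<comment> \<open>The right-hand side is infinite.\<close>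
    case False
    then show ?thesis unfolding energy_functional_eq[OF \<phi> \<sigma>] by simp
  qed
qed

lemma gap_coefficient_pos: "0 < 1 / \<beta> - 2 * B"
proof -
  have "2 * B * \<beta> < 1" using \<beta>_small \<beta>_pos B_pos by (simp add: mult_ac)
  then show ?thesis using \<beta>_pos by (simp add: field_simps)
qed

lemma fixed_point_minimizes:
  assumes "admissible \<phi>" "convolve (gibbs_density \<phi>) = \<phi>" "prob_density \<sigma>"
  shows "energy_functional (gibbs_density \<phi>) \<le> energy_functional \<sigma>"
proof -
  have "0 \<le> (1 / \<beta> - 2 * B) * (LINT x|lborel. (sqrt (\<sigma> x) - sqrt (gibbs_density \<phi> x))\<^sup>2)"
    using gap_coefficient_pos by (intro mult_nonneg_nonneg) auto
  then have "energy_functional (gibbs_density \<phi>) + 0 \<le> energy_functional (gibbs_density \<phi>) +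
      ereal ((1 / \<beta> - 2 * B) * (LINT x|lborel. (sqrt (\<sigma> x) - sqrt (gibbs_density \<phi> x))\<^sup>2))"
    by (intro add_left_mono) simp
  with energy_functional_gap(2)[OF assms] show ?thesis by simp
qed

text \<open>The minimum is a finite number and can be cancelled in the gap inequality, whose
  coefficient is positive; the Hellinger integral must then vanish.\<close>

lemma minimizer_unique:
  assumes \<phi>: "admissible \<phi>" "convolve (gibbs_density \<phi>) = \<phi>" and \<sigma>: "prob_density \<sigma>"
    and le: "energy_functional \<sigma> \<le> energy_functional (gibbs_density \<phi>)"
  shows "AE x in lborel. \<sigma> x = gibbs_density \<phi> x"
proof -
  let ?h = "\<lambda>x. (sqrt (\<sigma> x) - sqrt (gibbs_density \<phi> x))\<^sup>2"
  have "entropy_density \<phi> (gibbs_density \<phi>) = (\<lambda>_. 0)"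
    using gibbs_density_pos[OF \<phi>(1)] by (auto simp: entropy_density_def fun_eq_iff less_imp_neq[symmetric])
  then obtain e where e: "energy_functional (gibbs_density \<phi>) = ereal e"
    using energy_functional_eq[OF \<phi>(1) prob_density_gibbs_density[OF \<phi>(1)]] by simp
  have "ereal e + ereal ((1 / \<beta> - 2 * B) * (LINT x|lborel. ?h x)) \<le> ereal e"
    using order_trans[OF energy_functional_gap(2)[OF \<phi> \<sigma>] le] unfolding e .
  then have "(1 / \<beta> - 2 * B) * (LINT x|lborel. ?h x) \<le> 0" by simp
  then have "(LINT x|lborel. ?h x) \<le> 0" using gap_coefficient_pos by (simp add: mult_le_0_iff)
  moreover have "0 \<le> (LINT x|lborel. ?h x)" by (intro Bochner_Integration.integral_nonneg) simp
  ultimately have "(LINT x|lborel. ?h x) = 0" by simp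
  then have "AE x in lborel. ?h x = 0"
    using energy_functional_gap(1)[OF \<phi> \<sigma>] by (subst (asm) integral_nonneg_eq_0_iff_AE) auto
  then show ?thesis by eventually_elim simp
qed

end

section \<open>Completed product measures\<close>

lemma measurable_completion_AE:
  fixes f g :: "'b \<Rightarrow> 'c::{banach, second_countable_topology}"
  assumes ae: "AE x in M. f x = g x" and g: "g \<in> borel_measurable M"
  shows "f \<in> borel_measurable (completion M)"
proof (rule measurableI)
  fix A :: "'c set" assume A: "A \<in> sets borel"
  show "f -` A \<inter> space (completion M) \<in> sets (completion M)"
  proof (rule completion.in_sets_AE)
    show "AE x in completion M. x \<in> g -` A \<inter> space M \<longleftrightarrow> x \<in> f -` A \<inter> space (completion M)"
      using AE_completion[OF ae] by eventually_elim auto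
    show "g -` A \<inter> space M \<in> sets (completion M)"
      using measurable_sets[OF g A] by auto
  qed auto
qed simp

text \<open>Reduces integrals of Lebesgue-measurable data to Borel versions on the uncompleted
  measure.\<close>

lemma integral_completion_AE:
  fixes f g :: "'b \<Rightarrow> 'c::{banach, second_countable_topology}"
  assumes ae: "AE x in M. f x = g x" and g: "g \<in> borel_measurable M"
  shows "integral\<^sup>L (completion M) f = integral\<^sup>L M g"
    and "integrable (completion M) f \<longleftrightarrow> integrable M g"
proof -
  note f = measurable_completion_AE[OF ae g] and g' = measurable_completion[OF g]
  show "integral\<^sup>L (completion M) f = integral\<^sup>L M g"
    using integral_cong_AE[OF f g' AE_completion[OF ae]] integral_completion[OF g] by simp
  show "integrable (completion M) f \<longleftrightarrow> integrable M g"
    using integrable_cong_AE[OF f g' AE_completion[OF ae]] integrable_completion[OF g] by simp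
qed

text \<open>By Fubini in coordinate \<open>i\<close>: the exceptional set is null on every line in
  that direction.\<close>

lemma AE_PiM_lborel_slice:
  fixes P :: "('i \<Rightarrow> 'a::euclidean_space) \<Rightarrow> bool"
  assumes I: "finite I" "i \<in> I" and [measurable]: "Measurable.pred (\<Pi>\<^sub>M i\<in>I. lborel) P"
    and slice: "\<And>x. AE y in lborel. P (x(i := y))"
  shows "AE x in (\<Pi>\<^sub>M i\<in>I. lborel). P x"
proof -
  interpret product_sigma_finite "\<lambda>_::'i. lborel :: 'a measure" by standard
  let ?J = "I - {i}"
  have ins: "insert i ?J = I" and J: "finite ?J" "i \<notin> ?J" using I by auto
  have meas: "indicator {x. \<not> P x} \<in> borel_measurable (Pi\<^sub>M I (\<lambda>_. lborel))"
    by (intro borel_measurable_indicator') measurable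
  have "integral\<^sup>N (Pi\<^sub>M I (\<lambda>_. lborel)) (indicator {x. \<not> P x}) =
      (\<integral>\<^sup>+x. (\<integral>\<^sup>+y. indicator {x. \<not> P x} (x(i := y)) \<partial>lborel) \<partial>Pi\<^sub>M ?J (\<lambda>_. lborel))"
    using product_nn_integral_insert[OF J, of "indicator {x. \<not> P x}"] meas unfolding ins by simp
  also have "\<dots> = (\<integral>\<^sup>+(x :: 'i \<Rightarrow> 'a). 0 \<partial>Pi\<^sub>M ?J (\<lambda>_. lborel))"
  proof (intro nn_integral_cong)
    fix x
    have "(\<integral>\<^sup>+y. indicator {x. \<not> P x} (x(i := y)) \<partial>lborel) = (\<integral>\<^sup>+(y::'a). 0 \<partial>lborel)"
      using slice[of x] by (intro nn_integral_cong_AE) (auto elim!: AE_mp)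
    then show "(\<integral>\<^sup>+y. indicator {x. \<not> P x} (x(i := y)) \<partial>lborel) = 0" by simp
  qed
  finally show ?thesis by (subst AE_iff_nn_integral) auto
qed

lemma AE_PiM_lborel_component:
  assumes "finite I" "i \<in> I" and ae: "AE x in lborel. P (x::'a::euclidean_space)"
  shows "AE x in (\<Pi>\<^sub>M i\<in>I. lborel). P (x i)"
proof -
  obtain M where M: "{x. \<not> P x} \<subseteq> M" "emeasure lborel M = 0" and [measurable]: "M \<in> sets borel"
    using ae by (auto elim!: AE_E)
  have "AE x in lborel. x \<notin> M" using M by (intro AE_not_in) (simp add: null_sets_def)
  then have "AE x in (\<Pi>\<^sub>M i\<in>I. lborel). x i \<notin> M"
    using assms(2) by (intro AE_PiM_lborel_slice[OF assms(1,2)]) (auto simp: )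
  then show ?thesis using M(1) by (auto elim!: AE_mp)
qed

text \<open>On a line in direction \<open>i\<close> the entry \<open>x j\<close> is frozen, since
  \<open>i \<noteq> j\<close>, and the exceptional set is a translate of a null set.\<close>

lemma AE_PiM_lborel_diff:
  assumes "finite I" "i \<in> I" "j \<in> I" "i \<noteq> j" and ae: "AE x in lborel. P (x::'a::euclidean_space)"
  shows "AE x in (\<Pi>\<^sub>M i\<in>I. lborel). P (x i - x j)"
proof -
  obtain M where M: "{x. \<not> P x} \<subseteq> M" "emeasure lborel M = 0" and [measurable]: "M \<in> sets borel"
    using ae by (auto elim!: AE_E)
  have M': "AE x in lborel. x \<notin> M" using M by (intro AE_not_in) (simp add: null_sets_def)
  have "AE y in lborel. y - x j \<notin> M" for x
    using AE_lborel_translate[OF M', of "- x j"] by simp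
  then have "AE x in (\<Pi>\<^sub>M i\<in>I. lborel). x i - x j \<notin> M"
    using assms(2-4) by (intro AE_PiM_lborel_slice[OF assms(1,2)]) auto
  then show ?thesis using M(1) by (auto elim!: AE_mp)
qed

lemma AE_energy_eq:
  fixes U U' W W' :: "'a::euclidean_space \<Rightarrow> real"
  assumes U: "AE x in lborel. U x = U' x" and W: "AE x in lborel. W x = W' x"
  shows "AE x in (\<Pi>\<^sub>M i\<in>{1..N}. lborel). energy U W N x = energy U' W' N x"
proof -
  have "AE x in (\<Pi>\<^sub>M i\<in>{1..N}. lborel). \<forall>i\<in>{1..N}. U (x i) = U' (x i)"
    using U by (intro AE_finite_allI AE_PiM_lborel_component) auto
  moreover have "AE x in (\<Pi>\<^sub>M i\<in>{1..N}. lborel). \<forall>i\<in>{1..N}. \<forall>j\<in>{1..N} - {i}. W (x i - x j) = W' (x i - x j)"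
    using W by (intro AE_finite_allI AE_PiM_lborel_diff) auto
  ultimately show ?thesis
    by eventually_elim (simp add: energy_def)
qed

text \<open>A product measure is determined by its values on boxes, and on a box both the density
  and the indicator factorize.\<close>

lemma PiM_density:
  fixes \<rho> :: "'a::euclidean_space \<Rightarrow> real"
  assumes [measurable]: "\<rho> \<in> borel_measurable borel" and \<rho>: "\<And>x. 0 \<le> \<rho> x"
    and sf: "prob_space (density lborel \<rho>)" and I: "finite I"
  shows "(\<Pi>\<^sub>M i\<in>I. density lborel \<rho>) = density (\<Pi>\<^sub>M i\<in>I. lborel) (\<lambda>x. ennreal (\<Prod>i\<in>I. \<rho> (x i)))"
proof -
  interpret R: prob_space "density lborel \<rho>" by fact
  interpret R: product_sigma_finite "\<lambda>_. density lborel \<rho>" by standard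
  interpret L: product_sigma_finite "\<lambda>_. lborel :: 'a measure" by standard
  have sets_eq: "sets (\<Pi>\<^sub>M i\<in>I. density lborel \<rho>) = sets (\<Pi>\<^sub>M i\<in>I. lborel)"
    by (intro sets_PiM_cong) auto
  show ?thesis
  proof (rule R.PiM_eqI[OF I, symmetric])
    show "sets (density (\<Pi>\<^sub>M i\<in>I. lborel) (\<lambda>x. ennreal (\<Prod>i\<in>I. \<rho> (x i)))) = sets (\<Pi>\<^sub>M i\<in>I. density lborel \<rho>)"
      using sets_eq by simp
  next
    fix A assume "\<And>i. i \<in> I \<Longrightarrow> A i \<in> sets (density lborel \<rho>)"
    then have A[measurable]: "\<And>i. i \<in> I \<Longrightarrow> A i \<in> sets borel" by simp
    have P: "Pi\<^sub>E I A \<in> sets (\<Pi>\<^sub>M i\<in>I. lborel)" using I A by (intro sets_PiM_I_finite) auto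
    have "emeasure (density (\<Pi>\<^sub>M i\<in>I. lborel) (\<lambda>x. ennreal (\<Prod>i\<in>I. \<rho> (x i)))) (Pi\<^sub>E I A)
        = (\<integral>\<^sup>+x. ennreal (\<Prod>i\<in>I. \<rho> (x i)) * indicator (Pi\<^sub>E I A) x \<partial>(\<Pi>\<^sub>M i\<in>I. lborel))"
      using P by (intro emeasure_density) auto
    also have "\<dots> = (\<integral>\<^sup>+x. (\<Prod>i\<in>I. ennreal (\<rho> (x i)) * indicator (A i) (x i)) \<partial>(\<Pi>\<^sub>M i\<in>I. lborel))"
    proof (intro nn_integral_cong)
      fix x assume "x \<in> space (\<Pi>\<^sub>M i\<in>I. (lborel :: 'a measure))"
      then have x: "x \<in> extensional I" by (simp add: space_PiM PiE_def)
      \<comment> \<open>The factorization of the box indicator relies on \<open>x\<close> being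
        extensional, which holds on the space of the product.\<close>
      have "indicator (Pi\<^sub>E I A) x = (\<Prod>i\<in>I. indicator (A i) (x i) :: ennreal)"
      proof (cases "\<forall>i\<in>I. x i \<in> A i")
        case True
        then have "x \<in> Pi\<^sub>E I A" using x by (auto simp: PiE_def)
        with True show ?thesis by simp
      next
        case False
        then have "(\<Prod>i\<in>I. indicator (A i) (x i) :: ennreal) = 0"
          using I by (intro prod_zero) (auto simp: indicator_def)
        moreover have "x \<notin> Pi\<^sub>E I A" using False by auto
        ultimately show ?thesis by simp
      qed
      then show "ennreal (\<Prod>i\<in>I. \<rho> (x i)) * indicator (Pi\<^sub>E I A) x
          = (\<Prod>i\<in>I. ennreal (\<rho> (x i)) * indicator (A i) (x i))"
        using \<rho> by (simp add: prod.distrib prod_ennreal)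
    qed
    also have "\<dots> = (\<Prod>i\<in>I. \<integral>\<^sup>+y. ennreal (\<rho> y) * indicator (A i) y \<partial>lborel)"
      using I by (intro L.product_nn_integral_prod) auto
    also have "\<dots> = (\<Prod>i\<in>I. emeasure (density lborel \<rho>) (A i))"
      by (intro prod.cong refl emeasure_density[symmetric]) auto
    finally show "emeasure (density (\<Pi>\<^sub>M i\<in>I. lborel) (\<lambda>x. ennreal (\<Prod>i\<in>I. \<rho> (x i)))) (Pi\<^sub>E I A)
      = (\<Prod>i\<in>I. emeasure (density lborel \<rho>) (A i))" .
  qed
qed

lemma fourier_empirical:
  assumes "0 < N"
  shows "fourier (empirical N X) \<xi> = (\<Sum>i=1..N. cis (\<xi> \<bullet> X i)) /\<^sub>R real N"
proof -
  have "fourier (empirical N X) \<xi> = (LINT i|uniform_count_measure {1..N}. cis (\<xi> \<bullet> X i))"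
    unfolding fourier_def empirical_def
  proof (rule integral_distr)
    show "X \<in> uniform_count_measure {1..N} \<rightarrow>\<^sub>M lebesgue"
      by (auto simp: measurable_def space_uniform_count_measure sets_uniform_count_measure)
    have "(\<lambda>x. cis (\<xi> \<bullet> x)) \<in> borel_measurable borel"
      by (intro borel_measurable_continuous_onI continuous_intros)
    then show "(\<lambda>x. cis (\<xi> \<bullet> x)) \<in> borel_measurable lebesgue" by (auto intro: measurable_completion)
  qed
  also have "\<dots> = (\<Sum>i=1..N. cis (\<xi> \<bullet> X i)) /\<^sub>R real N"
    using assms by (simp add: uniform_count_measure_def lebesgue_integral_point_measure_finite
      scaleR_sum_right divide_inverse)
  finally show ?thesis .
qed

section \<open>The empirical measure under the Gibbs measure\<close>

text \<open>Centering may double the sup norm, hence the division by 2; squared, it reappears as the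
  4 in \<open>deviation\<close>.\<close>

lemma (in mean_field_gas) centered_half_deviation:
  assumes f: "f \<in> borel_measurable R" and le: "\<And>x. \<bar>f x\<bar> \<le> 1"
  shows "centered (\<lambda>x. (f x - (LINT y|R. f y)) / 2)"
proof -
  have "integrable R f" using f le by (intro integrable_const_bound[where B=1]) auto
  moreover have "\<bar>f x - (LINT y|R. f y)\<bar> \<le> 2" for x
    using le[of x] integral_bounded[of f 1, OF le] by linarith
  ultimately show ?thesis using f by (simp add: centered_def prob_space)
qed

context mean_field
begin

abbreviation R :: "('a \<Rightarrow> real) \<Rightarrow> 'a measure" where
  "R \<phi> \<equiv> density lborel (\<lambda>x. ennreal (gibbs_density \<phi> x))"

lemma prob_space_R:
  assumes \<phi>: "admissible \<phi>"
  shows "prob_space (R \<phi>)"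
proof
  note measurable_gibbs_density[OF \<phi>, measurable]
  have "emeasure (R \<phi>) (space (R \<phi>)) = (\<integral>\<^sup>+x. ennreal (gibbs_density \<phi> x) \<partial>lborel)"
    by (subst emeasure_density) (auto intro!: nn_integral_cong)
  also have "\<dots> = ennreal 1"
    using \<phi> by (subst nn_integral_eq_integral) (auto simp: integrable_gibbs_density integral_gibbs_density gibbs_density_pos less_imp_le)
  finally show "emeasure (R \<phi>) (space (R \<phi>)) = 1" by simp
qed

lemma mean_field_gas_gibbs_density:
  assumes \<phi>: "admissible \<phi>" and I: "finite I" "2 \<le> card I"
  shows "mean_field_gas (R \<phi>) (\<lambda>x y. W (x - y)) B \<beta> I"
proof -
  interpret R: prob_space "R \<phi>" by (rule prob_space_R[OF \<phi>])
  show ?thesis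
  proof
    show "case_prod (\<lambda>x y. W (x - y)) \<in> borel_measurable (R \<phi> \<Otimes>\<^sub>M R \<phi>)"
      by measurable
    show "W (x - y) = W (y - x)" for x y using W_sym[of "y - x"] by simp
  qed (use I W_bound B_pos \<beta>_pos \<beta>_small in auto)
qed

end

section \<open>The Gibbs measure as a reweighted product law\<close>

locale mean_field_gibbs = mean_field U W B \<beta>
  for U W :: "'a::euclidean_space \<Rightarrow> real" and B \<beta> :: real +
  fixes \<phi> :: "'a \<Rightarrow> real" and N :: nat and I :: "nat set"
  assumes \<phi>: "admissible \<phi>" and fixed: "convolve (gibbs_density \<phi>) = \<phi>" and N: "2 \<le> N"
    and I: "I = {1..N}"
begin

lemma finite_I: "finite I" and card_I: "card I = N"
  by (simp_all add: I)

sublocale gas: mean_field_gas "R \<phi>" "\<lambda>x y. W (x - y)" B \<beta> I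
  by (rule mean_field_gas_gibbs_density[OF \<phi> finite_I]) (simp add: card_I N)

abbreviation L :: "(nat \<Rightarrow> 'a) measure" where "L \<equiv> \<Pi>\<^sub>M i\<in>I. lborel"

lemmas gibbs_density_measurable [measurable] = measurable_gibbs_density[OF \<phi>]

text \<open>This is where self-consistency enters the particle system: the mean field generated by
  \<open>R \<phi>\<close> is \<phi> itself.\<close>

lemma pot_eq: "gas.pot = \<phi>"
proof
  fix x
  have "gas.pot x = (LINT y|lborel. gibbs_density \<phi> y *\<^sub>R W (x - y))"
    unfolding gas.pot_def using gibbs_density_pos[OF \<phi>] by (intro integral_density) (auto intro: less_imp_le)
  also have "\<dots> = convolve (gibbs_density \<phi>) x" by (simp add: convolve_def mult.commute)
  finally show "gas.pot x = \<phi> x" by (simp add: fixed)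
qed

text \<open>Adding and subtracting \<phi> at each particle splits the energy into one-body terms,
  which give the product of Gibbs densities, and \<open>gas.ham\<close>.\<close>

lemma exp_energy_eq:
  "exp (- \<beta> * energy U W N x) = partition \<phi> ^ N * ((\<Prod>i\<in>I. gibbs_density \<phi> (x i)) * gas.weight x)"
proof -
  have "energy U W N x = (\<Sum>i\<in>I. U (x i) + \<phi> (x i)) + gas.ham x"
    unfolding energy_def gas.ham_def pot_eq I[symmetric] card_I by (simp add: sum.distrib)
  then have "exp (- \<beta> * energy U W N x) = exp (\<Sum>i\<in>I. - \<beta> * (U (x i) + \<phi> (x i))) * gas.weight x"
    by (simp add: gas.weight_def distrib_left sum_distrib_left sum_negf flip: exp_add)
  also have "exp (\<Sum>i\<in>I. - \<beta> * (U (x i) + \<phi> (x i))) = (\<Prod>i\<in>I. partition \<phi> * gibbs_density \<phi> (x i))"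
    using partition_pos[OF \<phi>] by (subst exp_sum) (auto simp: gibbs_density_def finite_I)
  finally show ?thesis by (simp add: prod.distrib card_I)
qed

lemma Q_eq: "gas.Q = density L (\<lambda>x. ennreal (\<Prod>i\<in>I. gibbs_density \<phi> (x i)))"
  using gibbs_density_pos[OF \<phi>] prob_space_R[OF \<phi>] by (intro PiM_density finite_I) (auto intro: less_imp_le)

lemma sets_Q [measurable_cong]: "sets gas.Q = sets L"
  by (simp add: Q_eq)

lemma prod_gibbs_density_nonneg: "0 \<le> (\<Prod>i\<in>I. gibbs_density \<phi> (x i))"
  using gibbs_density_pos[OF \<phi>] by (intro prod_nonneg) (simp add: less_imp_le)

lemma weight_L_measurable [measurable]: "gas.weight \<in> borel_measurable L"
  using gas.measurable_weight by (simp cong: measurable_cong_sets add: sets_Q)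

lemma partition_eq: "(LINT x|L. exp (- \<beta> * energy U W N x)) = partition \<phi> ^ N * gas.wmean (\<lambda>_. 1)"
proof -
  have "gas.wmean (\<lambda>_. 1) = (LINT x|L. (\<Prod>i\<in>I. gibbs_density \<phi> (x i)) *\<^sub>R (gas.weight x * 1))"
    unfolding gas.wmean_def Q_eq using prod_gibbs_density_nonneg by (intro integral_density) auto
  then show ?thesis unfolding exp_energy_eq by simp
qed

text \<open>The constant \<open>partition \<phi> ^ N\<close> cancels between the Boltzmann factor
  and its normalization.\<close>

lemma gibbs_nn_integral:
  assumes [measurable]: "H \<in> borel_measurable L"
  shows "(\<integral>\<^sup>+X. ennreal (exp (- \<beta> * energy U W N X) / (LINT x|L. exp (- \<beta> * energy U W N x))) * H X \<partial>L)
    = (\<integral>\<^sup>+X. ennreal (gas.weight X / gas.wmean (\<lambda>_. 1)) * H X \<partial>gas.Q)"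
proof -
  have "(\<integral>\<^sup>+X. ennreal (gas.weight X / gas.wmean (\<lambda>_. 1)) * H X \<partial>gas.Q)
      = (\<integral>\<^sup>+X. ennreal (\<Prod>i\<in>I. gibbs_density \<phi> (X i)) * (ennreal (gas.weight X / gas.wmean (\<lambda>_. 1)) * H X) \<partial>L)"
    unfolding Q_eq by (intro nn_integral_density) auto
  also have "\<dots> = (\<integral>\<^sup>+X. ennreal (exp (- \<beta> * energy U W N X) / (LINT x|L. exp (- \<beta> * energy U W N x))) * H X \<partial>L)"
  proof (intro nn_integral_cong)
    fix X
    have eq: "exp (- \<beta> * energy U W N X) / (LINT x|L. exp (- \<beta> * energy U W N x))
        = (\<Prod>i\<in>I. gibbs_density \<phi> (X i)) * (gas.weight X / gas.wmean (\<lambda>_. 1))"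
      unfolding partition_eq unfolding exp_energy_eq using partition_pos[OF \<phi>] by simp
    show "ennreal (\<Prod>i\<in>I. gibbs_density \<phi> (X i)) * (ennreal (gas.weight X / gas.wmean (\<lambda>_. 1)) * H X)
        = ennreal (exp (- \<beta> * energy U W N X) / (LINT x|L. exp (- \<beta> * energy U W N x))) * H X"
      unfolding eq ennreal_mult'[OF prod_gibbs_density_nonneg] by (simp only: mult.assoc)
  qed
  finally show ?thesis by simp
qed

section \<open>Fourier modes of the empirical measure\<close>

definition cos_dev :: "'a \<Rightarrow> 'a \<Rightarrow> real" where
  "cos_dev \<xi> x = (cos (\<xi> \<bullet> x) - (LINT y|R \<phi>. cos (\<xi> \<bullet> y))) / 2"

definition sin_dev :: "'a \<Rightarrow> 'a \<Rightarrow> real" where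
  "sin_dev \<xi> x = (sin (\<xi> \<bullet> x) - (LINT y|R \<phi>. sin (\<xi> \<bullet> y))) / 2"

lemma centered_cos_dev: "gas.centered (cos_dev \<xi>)" and centered_sin_dev: "gas.centered (sin_dev \<xi>)"
  unfolding cos_dev_def[abs_def] sin_dev_def[abs_def] by (intro gas.centered_half_deviation; simp)+

lemma measurable_cos_dev [measurable]: "case_prod cos_dev \<in> borel_measurable (borel \<Otimes>\<^sub>M borel)"
  and measurable_sin_dev [measurable]: "case_prod sin_dev \<in> borel_measurable (borel \<Otimes>\<^sub>M borel)"
  unfolding cos_dev_def[abs_def] sin_dev_def[abs_def] by measurable

text \<open>By \<open>deviation_eq\<close> this is the squared modulus of the difference of the
  Fourier transforms; the real form is visibly jointly measurable, as Tonelli requires, and is built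
  from test functions.\<close>

definition deviation :: "(nat \<Rightarrow> 'a) \<Rightarrow> 'a \<Rightarrow> real" where
  "deviation X \<xi> = 4 / (real N)\<^sup>2 * ((\<Sum>i\<in>I. cos_dev \<xi> (X i))\<^sup>2 + (\<Sum>i\<in>I. sin_dev \<xi> (X i))\<^sup>2)"

lemma measurable_deviation [measurable (raw)]:
  assumes [measurable]: "f \<in> M \<rightarrow>\<^sub>M L" "g \<in> borel_measurable M"
  shows "(\<lambda>x. deviation (f x) (g x)) \<in> borel_measurable M"
proof -
  have comp: "(\<lambda>x. f x i) \<in> borel_measurable M" if "i \<in> I" for i
    using measurable_compose[OF assms(1) measurable_component_singleton[OF that]] by simp
  have cos_dev: "(\<lambda>x. cos_dev (g x) (f x i)) \<in> borel_measurable M" if "i \<in> I" for i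
    using measurable_compose[OF measurable_Pair[OF assms(2) comp[OF that]] measurable_cos_dev] by simp
  have sin_dev: "(\<lambda>x. sin_dev (g x) (f x i)) \<in> borel_measurable M" if "i \<in> I" for i
    using measurable_compose[OF measurable_Pair[OF assms(2) comp[OF that]] measurable_sin_dev] by simp
  show ?thesis unfolding deviation_def
    by (intro borel_measurable_times borel_measurable_const borel_measurable_add borel_measurable_power borel_measurable_sum cos_dev sin_dev)
qed

lemma deviation_nonneg: "0 \<le> deviation X \<xi>"
  by (simp add: deviation_def)

lemma deviation_eq: "(cmod (fourier (empirical N X) \<xi> - fourier (R \<phi>) \<xi>))\<^sup>2 = deviation X \<xi>"
proof -
  have [measurable]: "(\<lambda>x. cis (\<xi> \<bullet> x)) \<in> borel_measurable borel"
    by (intro borel_measurable_continuous_onI continuous_intros)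
  have int: "integrable (R \<phi>) (\<lambda>x. cis (\<xi> \<bullet> x))"
    by (intro gas.integrable_const_bound[where B=1]) auto
  have Re_Im: "Re (fourier (R \<phi>) \<xi>) = (LINT y|R \<phi>. cos (\<xi> \<bullet> y))" "Im (fourier (R \<phi>) \<xi>) = (LINT y|R \<phi>. sin (\<xi> \<bullet> y))"
    using integral_bounded_linear[OF bounded_linear_Re int] integral_bounded_linear[OF bounded_linear_Im int]
    by (simp_all add: fourier_def)
  have "Re (fourier (empirical N X) \<xi> - fourier (R \<phi>) \<xi>) = 2 / N * (\<Sum>i\<in>I. cos_dev \<xi> (X i))"
    "Im (fourier (empirical N X) \<xi> - fourier (R \<phi>) \<xi>) = 2 / N * (\<Sum>i\<in>I. sin_dev \<xi> (X i))"
  proof -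
    have dev: "2 / N * (\<Sum>i\<in>I. (f (X i) - c) / 2) = inverse (real N) * (\<Sum>i\<in>I. f (X i)) - c" for f c
    proof -
      have "(\<Sum>i\<in>I. (f (X i) - c) / 2) = ((\<Sum>i\<in>I. f (X i)) - N * c) / 2"
        by (simp add: card_I sum_subtractf flip: sum_divide_distrib)
      then show ?thesis using N by (simp add: field_simps)
    qed
    have emp: "fourier (empirical N X) \<xi> = (\<Sum>i\<in>I. cis (\<xi> \<bullet> X i)) /\<^sub>R real N"
      unfolding I using N by (intro fourier_empirical) simp
    show "Re (fourier (empirical N X) \<xi> - fourier (R \<phi>) \<xi>) = 2 / N * (\<Sum>i\<in>I. cos_dev \<xi> (X i))"
      "Im (fourier (empirical N X) \<xi> - fourier (R \<phi>) \<xi>) = 2 / N * (\<Sum>i\<in>I. sin_dev \<xi> (X i))"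
      using dev[of "\<lambda>x. cos (\<xi> \<bullet> x)"] dev[of "\<lambda>x. sin (\<xi> \<bullet> x)"] Re_Im
      unfolding cos_dev_def sin_dev_def by (simp_all add: emp)
  qed
  then show ?thesis
    unfolding cmod_power2 deviation_def by (simp add: power_mult_distrib power_divide distrib_left)
qed

lemma wmean_deviation_le: "gas.wmean (\<lambda>X. deviation X \<xi>) \<le> 24 / N * gas.wmean (\<lambda>_. 1)"
proof -
  have bounded_observable: "gas.bounded_observable (\<lambda>X. (\<Sum>i\<in>I. cos_dev \<xi> (X i))\<^sup>2)" "gas.bounded_observable (\<lambda>X. (\<Sum>i\<in>I. sin_dev \<xi> (X i))\<^sup>2)"
    by (rule gas.bounded_observable_power2 gas.bounded_observable_sum gas.bounded_observable_centered centered_cos_dev centered_sin_dev | assumption)+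
  have "gas.wmean (\<lambda>X. deviation X \<xi>) = 4 / (real N)\<^sup>2 *
      (gas.wmean (\<lambda>X. (\<Sum>i\<in>I. cos_dev \<xi> (X i))\<^sup>2) + gas.wmean (\<lambda>X. (\<Sum>i\<in>I. sin_dev \<xi> (X i))\<^sup>2))"
    unfolding deviation_def gas.wmean_cmult gas.wmean_add[OF bounded_observable] ..
  \<comment> \<open>One second moment of at most \<open>3 * N\<close> for the cosine and one for the
    sine, which makes 24 in total.\<close>
  also have "\<dots> \<le> 4 / (real N)\<^sup>2 * (3 * real N * gas.wmean (\<lambda>_. 1) + 3 * real N * gas.wmean (\<lambda>_. 1))"
    using gas.wmean_power2_sum_le[OF centered_cos_dev, of \<xi>] gas.wmean_power2_sum_le[OF centered_sin_dev, of \<xi>] card_I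
    by (intro mult_left_mono add_mono) auto
  also have "\<dots> = 24 / N * gas.wmean (\<lambda>_. 1)"
    using N by (simp add: power2_eq_square)
  finally show ?thesis .
qed

lemma nn_integral_deviation_le:
  "(\<integral>\<^sup>+X. ennreal (gas.weight X / gas.wmean (\<lambda>_. 1)) * ennreal (deviation X \<xi>) \<partial>gas.Q) \<le> ennreal (24 / N)"
proof -
  have bounded_observable: "gas.bounded_observable (\<lambda>X. deviation X \<xi>)"
    unfolding deviation_def
    by (rule gas.bounded_observable_mult gas.bounded_observable_const
        gas.bounded_observable_add gas.bounded_observable_power2
        gas.bounded_observable_sum gas.bounded_observable_centered centered_cos_dev centered_sin_dev | assumption)+
  have Z: "0 < gas.wmean (\<lambda>_. 1)" by (rule gas.wmean_1_pos)
  have nn: "0 \<le> gas.weight X" for X using gas.weight_pos[of X] by simp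
  have "(\<integral>\<^sup>+X. ennreal (gas.weight X / gas.wmean (\<lambda>_. 1)) * ennreal (deviation X \<xi>) \<partial>gas.Q)
      = (\<integral>\<^sup>+X. ennreal (gas.weight X * deviation X \<xi> / gas.wmean (\<lambda>_. 1)) \<partial>gas.Q)"
    using Z deviation_nonneg nn by (intro nn_integral_cong) (simp flip: ennreal_mult)
  also have "\<dots> = ennreal (LINT X|gas.Q. gas.weight X * deviation X \<xi> / gas.wmean (\<lambda>_. 1))"
    using Z deviation_nonneg nn gas.bounded_observable_integrable[OF bounded_observable] by (intro nn_integral_eq_integral) auto
  also have "(LINT X|gas.Q. gas.weight X * deviation X \<xi> / gas.wmean (\<lambda>_. 1)) = gas.wmean (\<lambda>X. deviation X \<xi>) / gas.wmean (\<lambda>_. 1)"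
    by (simp add: gas.wmean_def)
  also have "\<dots> \<le> 24 / N"
    using wmean_deviation_le[of \<xi>] Z by (simp add: divide_le_eq)
  finally show ?thesis by (simp add: ennreal_leI)
qed

text \<open>Tonelli: the expectation is taken first at each frequency, where the bound
  \<open>24 / N\<close> is uniform, and the weight is integrated afterwards.\<close>

lemma gibbs_deviation_le:
  assumes [measurable]: "w \<in> borel_measurable borel" and w: "\<And>\<xi>. 0 \<le> w \<xi>"
  shows "(\<integral>\<^sup>+X. ennreal (exp (- \<beta> * energy U W N X) / (LINT x|L. exp (- \<beta> * energy U W N x)))
      * (\<integral>\<^sup>+\<xi>. ennreal (w \<xi> * deviation X \<xi>) \<partial>lborel) \<partial>L) \<le> ennreal (24 / N) * (\<integral>\<^sup>+\<xi>. ennreal (w \<xi>) \<partial>lborel)"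
proof -
  interpret pair_sigma_finite gas.Q lborel ..
  let ?p = "\<lambda>X. ennreal (gas.weight X / gas.wmean (\<lambda>_. 1))"
  have "(\<integral>\<^sup>+X. ennreal (exp (- \<beta> * energy U W N X) / (LINT x|L. exp (- \<beta> * energy U W N x)))
      * (\<integral>\<^sup>+\<xi>. ennreal (w \<xi> * deviation X \<xi>) \<partial>lborel) \<partial>L)
      = (\<integral>\<^sup>+X. ?p X * (\<integral>\<^sup>+\<xi>. ennreal (w \<xi> * deviation X \<xi>) \<partial>lborel) \<partial>gas.Q)"
    by (rule gibbs_nn_integral) measurable
  also have "\<dots> = (\<integral>\<^sup>+X. (\<integral>\<^sup>+\<xi>. ennreal (w \<xi>) * (?p X * ennreal (deviation X \<xi>)) \<partial>lborel) \<partial>gas.Q)"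
  proof (intro nn_integral_cong)
    fix X assume X[measurable]: "X \<in> space gas.Q"
    then have [measurable]: "X \<in> space L" using sets_eq_imp_space_eq[OF sets_Q] by simp
    have [measurable]: "deviation X \<in> borel_measurable borel" by measurable
    have "?p X * (\<integral>\<^sup>+\<xi>. ennreal (w \<xi> * deviation X \<xi>) \<partial>lborel)
        = (\<integral>\<^sup>+\<xi>. ?p X * ennreal (w \<xi> * deviation X \<xi>) \<partial>lborel)"
      by (rule nn_integral_cmult[symmetric]) measurable
    also have "\<dots> = (\<integral>\<^sup>+\<xi>. ennreal (w \<xi>) * (?p X * ennreal (deviation X \<xi>)) \<partial>lborel)"
      using w deviation_nonneg by (intro nn_integral_cong) (simp add: ennreal_mult' mult_ac)
    finally show "?p X * (\<integral>\<^sup>+\<xi>. ennreal (w \<xi> * deviation X \<xi>) \<partial>lborel)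
        = (\<integral>\<^sup>+\<xi>. ennreal (w \<xi>) * (?p X * ennreal (deviation X \<xi>)) \<partial>lborel)" .
  qed
  also have "\<dots> = (\<integral>\<^sup>+\<xi>. (\<integral>\<^sup>+X. ennreal (w \<xi>) * (?p X * ennreal (deviation X \<xi>)) \<partial>gas.Q) \<partial>lborel)"
    by (rule Fubini'[symmetric]) measurable
  also have "\<dots> = (\<integral>\<^sup>+\<xi>. ennreal (w \<xi>) * (\<integral>\<^sup>+X. ?p X * ennreal (deviation X \<xi>) \<partial>gas.Q) \<partial>lborel)"
    by (intro nn_integral_cong nn_integral_cmult) measurable
  also have "\<dots> \<le> (\<integral>\<^sup>+\<xi>. ennreal (w \<xi>) * ennreal (24 / N) \<partial>lborel)"
    by (intro nn_integral_mono mult_left_mono nn_integral_deviation_le) simp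
  also have "\<dots> = (\<integral>\<^sup>+\<xi>. ennreal (w \<xi>) \<partial>lborel) * ennreal (24 / N)"
    by (rule nn_integral_multc) measurable
  finally show ?thesis by (simp add: mult.commute)
qed

end

section \<open>Passage from Borel versions to Lebesgue-measurable data\<close>

lemma integral_lebesgue_convolution_AE:
  fixes W W' \<sigma> \<sigma>' :: "'a::euclidean_space \<Rightarrow> real"
  assumes W: "AE x in lborel. W x = W' x" "W' \<in> borel_measurable borel"
    and \<sigma>: "AE x in lborel. \<sigma> x = \<sigma>' x" "\<sigma>' \<in> borel_measurable borel"
  shows "convol W \<sigma> x = (LINT y|lborel. W' (x - y) * \<sigma>' y)"
  unfolding convol_def
proof (rule integral_completion_AE)
  show "AE y in lborel. W (x - y) * \<sigma> y = W' (x - y) * \<sigma>' y"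
    using AE_lborel_reflect[OF W(1), of x] \<sigma>(1) by eventually_elim simp
  note [measurable] = W(2) \<sigma>(2)
  show "(\<lambda>y. W' (x - y) * \<sigma>' y) \<in> borel_measurable lborel" by measurable
qed

lemma fourier_density_lebesgue_AE:
  fixes \<rho> \<rho>' :: "'a::euclidean_space \<Rightarrow> real"
  assumes ae: "AE x in lborel. \<rho> x = \<rho>' x" and [measurable]: "\<rho>' \<in> borel_measurable borel"
    and nn: "\<And>x. 0 \<le> \<rho> x" "\<And>x. 0 \<le> \<rho>' x"
  shows "fourier (density lebesgue (\<lambda>x. ennreal (\<rho> x))) \<xi> = fourier (density lborel (\<lambda>x. ennreal (\<rho>' x))) \<xi>"
proof -
  have [measurable]: "(\<lambda>x. cis (\<xi> \<bullet> x)) \<in> borel_measurable borel"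
    by (intro borel_measurable_continuous_onI continuous_intros)
  have "\<rho> \<in> borel_measurable lebesgue"
    by (rule measurable_completion_AE[OF ae]) simp
  then have "fourier (density lebesgue (\<lambda>x. ennreal (\<rho> x))) \<xi> = (LINT x|lebesgue. \<rho> x *\<^sub>R cis (\<xi> \<bullet> x))"
    unfolding fourier_def using nn by (intro integral_density) (auto intro: measurable_completion)
  also have "\<dots> = (LINT x|lborel. \<rho>' x *\<^sub>R cis (\<xi> \<bullet> x))"
    using ae by (intro integral_completion_AE) (auto elim!: AE_mp)
  also have "\<dots> = fourier (density lborel (\<lambda>x. ennreal (\<rho>' x))) \<xi>"
    unfolding fourier_def using nn by (intro integral_density[symmetric]) auto
  finally show ?thesis .
qed

context mean_field
begin

lemma free_energy_eq:
  assumes U0: "AE x in lborel. U0 x = U x" and W0: "AE x in lborel. W0 x = W x"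
    and \<sigma>: "AE x in lborel. \<sigma> x = \<sigma>' x" and [measurable]: "\<sigma>' \<in> borel_measurable borel"
  shows "free_energy \<beta> U0 W0 \<sigma> = energy_functional \<sigma>'"
proof -
  have "ext_integral lebesgue (\<lambda>x. U0 x * \<sigma> x + 1 / \<beta> * (\<sigma> x * ln (\<sigma> x)))
      = ext_integral lborel (\<lambda>x. U x * \<sigma>' x + 1 / \<beta> * (\<sigma>' x * ln (\<sigma>' x)))"
    unfolding ext_integral_def nn_integral_completion
    using U0 \<sigma> by (intro arg_cong2[where f="(-)"] arg_cong[where f=enn2ereal] nn_integral_cong_AE)
      (auto elim!: AE_mp)
  moreover have "convol W0 \<sigma> = convolve \<sigma>'"
    using integral_lebesgue_convolution_AE[OF W0 W_measurable \<sigma>] by (simp add: fun_eq_iff convolve_def)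
  moreover have "(LINT x|lebesgue. \<sigma> x * convolve \<sigma>' x) = (LINT x|lborel. \<sigma>' x * convolve \<sigma>' x)"
  proof (rule integral_completion_AE)
    show "AE x in lborel. \<sigma> x * convolve \<sigma>' x = \<sigma>' x * convolve \<sigma>' x" using \<sigma> by eventually_elim simp
    show "(\<lambda>x. \<sigma>' x * convolve \<sigma>' x) \<in> borel_measurable lborel" unfolding convolve_def by measurable
  qed
  ultimately show ?thesis unfolding free_energy_def energy_functional_def by simp
qed

lemma prob_densities_borel_version:
  assumes "\<sigma> \<in> prob_densities"
  obtains \<sigma>' where "AE x in lborel. \<sigma> x = \<sigma>' x" "prob_density \<sigma>'"
proof -
  have \<sigma>: "\<sigma> \<in> borel_measurable lebesgue" "\<And>x. 0 \<le> \<sigma> x" "(\<integral>\<^sup>+x. ennreal (\<sigma> x) \<partial>lborel) = 1"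
    using assms by (auto simp: prob_densities_def nn_integral_completion)
  obtain s where s: "s \<in> borel_measurable borel" and ae: "AE x in lborel. \<sigma> x = s x"
    using borel_version[OF \<sigma>(1)] .
  \<comment> \<open>The Borel version is nonnegative only almost everywhere; the truncation restores
    this everywhere.\<close>
  define \<sigma>' where "\<sigma>' x = max 0 (s x)" for x
  have m: "\<sigma>' \<in> borel_measurable borel" unfolding \<sigma>'_def[abs_def] using s by measurable
  have ae': "AE x in lborel. \<sigma> x = \<sigma>' x"
    using ae
  proof eventually_elim
    show "\<sigma> x = \<sigma>' x" if "\<sigma> x = s x" for x
      using \<sigma>(2)[of x] that by (simp add: \<sigma>'_def)
  qed
  have "(\<integral>\<^sup>+x. ennreal (\<sigma>' x) \<partial>lborel) = (\<integral>\<^sup>+x. ennreal (\<sigma> x) \<partial>lborel)"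
    using ae' by (intro nn_integral_cong_AE) (auto elim!: AE_mp)
  then have 1: "(\<integral>\<^sup>+x. ennreal (\<sigma>' x) \<partial>lborel) = 1" using \<sigma>(3) by simp
  have "integrable lborel \<sigma>'"
    using m 1 by (intro integrableI_nonneg) (auto simp: \<sigma>'_def)
  moreover from this have "(LINT x|lborel. \<sigma>' x) = 1"
    using 1 by (subst integral_eq_nn_integral) (auto simp: \<sigma>'_def)
  ultimately have "prob_density \<sigma>'" by (simp add: prob_density_def \<sigma>'_def)
  with ae' show ?thesis by (rule that)
qed

lemma prob_density_measurable: "prob_density \<sigma> \<Longrightarrow> \<sigma> \<in> borel_measurable borel"
  by (auto simp: prob_density_def)

text \<open>The free energy does not see null sets, so existence and uniqueness carry over from
  Borel densities, and a minimizer is determined up to a null set.\<close>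

lemma
  assumes U0: "AE x in lborel. U0 x = U x" and W0: "AE x in lborel. W0 x = W x"
    and \<phi>: "admissible \<phi>" "convolve (gibbs_density \<phi>) = \<phi>"
  shows fixed_point_is_minimizer: "is_minimizer \<beta> U0 W0 (gibbs_density \<phi>)"
    and minimizer_AE_eq_fixed_point: "is_minimizer \<beta> U0 W0 \<rho> \<Longrightarrow> AE x in lborel. \<rho> x = gibbs_density \<phi> x"
proof -
  have g: "gibbs_density \<phi> \<in> prob_densities"
    using \<phi>(1) prob_space.emeasure_space_1[OF prob_space_R[OF \<phi>(1)]] measurable_gibbs_density[OF \<phi>(1)] gibbs_density_pos[OF \<phi>(1)]
    by (auto simp: prob_densities_def nn_integral_completion emeasure_density less_imp_le intro: measurable_completion)
  have fg: "free_energy \<beta> U0 W0 (gibbs_density \<phi>) = energy_functional (gibbs_density \<phi>)"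
    by (rule free_energy_eq[OF U0 W0]) (auto simp: measurable_gibbs_density \<phi>)
  have "free_energy \<beta> U0 W0 (gibbs_density \<phi>) \<le> free_energy \<beta> U0 W0 \<sigma>" if "\<sigma> \<in> prob_densities" for \<sigma>
  proof -
    obtain \<sigma>' where "AE x in lborel. \<sigma> x = \<sigma>' x" "prob_density \<sigma>'"
      using prob_densities_borel_version[OF \<open>\<sigma> \<in> prob_densities\<close>] .
    then show ?thesis
      using fixed_point_minimizes[OF \<phi>] free_energy_eq[OF U0 W0 _ prob_density_measurable] fg by simp
  qed
  with g show "is_minimizer \<beta> U0 W0 (gibbs_density \<phi>)" by (simp add: is_minimizer_def)
  assume "is_minimizer \<beta> U0 W0 \<rho>"
  then have \<rho>: "\<rho> \<in> prob_densities" and le: "free_energy \<beta> U0 W0 \<rho> \<le> free_energy \<beta> U0 W0 (gibbs_density \<phi>)"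
    using g by (auto simp: is_minimizer_def)
  obtain \<rho>' where \<rho>': "AE x in lborel. \<rho> x = \<rho>' x" "prob_density \<rho>'"
    using prob_densities_borel_version[OF \<rho>] .
  then have "AE x in lborel. \<rho>' x = gibbs_density \<phi> x"
    using le unfolding fg free_energy_eq[OF U0 W0 \<rho>'(1) prob_density_measurable[OF \<rho>'(2)]]
    by (intro minimizer_unique[OF \<phi>])
  with \<rho>'(1) show "AE x in lborel. \<rho> x = gibbs_density \<phi> x" by eventually_elim simp
qed

end

context mean_field_gibbs
begin

text \<open>Replacing the data by Borel versions alters the Boltzmann factor only on a null set of
  configurations, and the Fourier transform of the minimizer not at all. The Gibbs expectation can
  then be computed on the uncompleted product.\<close>

lemma expected_Hneg_norm2_le:
  assumes U0: "AE x in lborel. U0 x = U x" and W0: "AE x in lborel. W0 x = W x"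
    and \<rho>: "AE x in lborel. \<rho> x = gibbs_density \<phi> x" "\<And>x. 0 \<le> \<rho> x"
  shows "(\<integral>\<^sup>+X. Hneg_norm2_diff \<alpha> (empirical N X) (density lebesgue (\<lambda>x. ennreal (\<rho> x))) \<partial>gibbs \<beta> U0 W0 N)
    \<le> ennreal (24 / N) * (\<integral>\<^sup>+\<xi>. ennreal ((1 + (norm \<xi>)\<^sup>2) powr (- \<alpha>)) \<partial>(lborel :: 'a measure))"
proof -
  let ?w = "\<lambda>\<xi>::'a. (1 + (norm \<xi>)\<^sup>2) powr (- \<alpha>)"
  let ?H = "\<lambda>X. \<integral>\<^sup>+\<xi>. ennreal (?w \<xi> * deviation X \<xi>) \<partial>lborel"
  have w[measurable]: "?w \<in> borel_measurable borel" by measurable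
  have H: "Hneg_norm2_diff \<alpha> (empirical N X) (density lebesgue (\<lambda>x. ennreal (\<rho> x))) = ?H X" for X
    unfolding Hneg_norm2_diff_def nn_integral_completion
    using fourier_density_lebesgue_AE[OF \<rho>(1) gibbs_density_measurable \<rho>(2)] gibbs_density_pos[OF \<phi>]
    by (simp add: less_imp_le deviation_eq)
  have [measurable]: "(\<lambda>x. energy U W N x) \<in> borel_measurable L"
    unfolding energy_def I[symmetric] by measurable
  have ae: "AE x in L. exp (- \<beta> * energy U0 W0 N x) = exp (- \<beta> * energy U W N x)"
    using AE_energy_eq[OF U0 W0, of N] unfolding I[symmetric] by eventually_elim simp
  have Z: "partition_fun \<beta> U0 W0 N = (LINT x|L. exp (- \<beta> * energy U W N x))"
    unfolding partition_fun_def lebesgue_conf_def I[symmetric]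
    by (rule integral_completion_AE[OF ae]) measurable
  have ae': "AE x in L. exp (- \<beta> * energy U0 W0 N x) / partition_fun \<beta> U0 W0 N
      = exp (- \<beta> * energy U W N x) / (LINT x|L. exp (- \<beta> * energy U W N x))"
    using ae unfolding Z by eventually_elim simp
  have [measurable]: "(\<lambda>x. exp (- \<beta> * energy U0 W0 N x) / partition_fun \<beta> U0 W0 N) \<in> borel_measurable (completion L)"
    by (rule measurable_completion_AE[OF ae']) measurable
  have HL: "?H \<in> borel_measurable L" by measurable
  then have [measurable]: "?H \<in> borel_measurable (completion L)" by (rule measurable_completion)
  have "(\<integral>\<^sup>+X. ?H X \<partial>gibbs \<beta> U0 W0 N)
      = (\<integral>\<^sup>+X. ennreal (exp (- \<beta> * energy U0 W0 N X) / partition_fun \<beta> U0 W0 N) * ?H X \<partial>completion L)"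
    unfolding gibbs_def lebesgue_conf_def I[symmetric] by (intro nn_integral_density) measurable
  also have "\<dots> = (\<integral>\<^sup>+X. ennreal (exp (- \<beta> * energy U W N X) / (LINT x|L. exp (- \<beta> * energy U W N x))) * ?H X \<partial>L)"
    unfolding nn_integral_completion using ae' by (intro nn_integral_cong_AE) (auto elim!: AE_mp)
  also have "\<dots> \<le> ennreal (24 / N) * (\<integral>\<^sup>+\<xi>. ennreal (?w \<xi>) \<partial>lborel)"
    by (rule gibbs_deviation_le[OF w]) simp
  finally show ?thesis unfolding H .
qed

end

text \<open>The two-particle energy exceeds \<open>U (x 1) + U (x 2)\<close> by at most
  \<open>B\<close>. The integral of the product of the two one-body factors, which is the square of
  the one-particle integral, is therefore finite.\<close>

lemma integrable_exp_potential:
  fixes U W :: "'a::euclidean_space \<Rightarrow> real"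
  assumes [measurable]: "U \<in> borel_measurable borel" "W \<in> borel_measurable borel"
    and W: "\<And>x. \<bar>W x\<bar> \<le> B" and \<beta>: "0 < \<beta>"
    and int: "integrable (\<Pi>\<^sub>M i\<in>{1..2::nat}. lborel) (\<lambda>x. exp (- \<beta> * energy U W 2 x))"
  shows "integrable lborel (\<lambda>x. exp (- \<beta> * U x))"
proof -
  interpret product_sigma_finite "\<lambda>_::nat. lborel :: 'a measure" by standard
  let ?M = "\<Pi>\<^sub>M i\<in>{1..2::nat}. (lborel :: 'a measure)"
  let ?u = "\<integral>\<^sup>+x. ennreal (exp (- \<beta> * U x)) \<partial>lborel"
  have I: "{1..2} = {1, 2::nat}" by auto
  have le: "(\<Prod>i\<in>{1..2}. exp (- \<beta> * U (x i))) \<le> exp (\<beta> * B) * exp (- \<beta> * energy U W 2 x)" for x :: "nat \<Rightarrow> 'a"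
  proof -
    have "{1, 2::nat} - {1} = {2}" "{1, 2::nat} - {2} = {1}" by auto
    then have e: "energy U W 2 x = U (x 1) + U (x 2) + (W (x 1 - x 2) + W (x 2 - x 1)) / 2"
      unfolding energy_def I by (simp add: numeral_2_eq_2)
    have "energy U W 2 x \<le> U (x 1) + U (x 2) + B"
      unfolding e using W[of "x 1 - x 2"] W[of "x 2 - x 1"] by (simp add: abs_le_iff field_simps)
    from mult_left_mono[OF this, of \<beta>] \<beta> show ?thesis
      unfolding I by (simp add: algebra_simps flip: exp_add)
  qed
  have "?u * ?u = (\<integral>\<^sup>+x. (\<Prod>i\<in>{1..2}. ennreal (exp (- \<beta> * U (x i)))) \<partial>?M)"
    by (subst product_nn_integral_prod) (simp_all add: I power2_eq_square)
  also have "\<dots> \<le> (\<integral>\<^sup>+x. ennreal (exp (\<beta> * B) * exp (- \<beta> * energy U W 2 x)) \<partial>?M)"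
    using le by (intro nn_integral_mono) (simp add: prod_ennreal ennreal_leI)
  also have "\<dots> < \<infinity>"
  proof -
    have "integrable ?M (\<lambda>x. exp (\<beta> * B) * exp (- \<beta> * energy U W 2 x))" using int by simp
    then have "(\<integral>\<^sup>+x. ennreal (norm (exp (\<beta> * B) * exp (- \<beta> * energy U W 2 x))) \<partial>?M) < \<infinity>"
      unfolding integrable_iff_bounded by blast
    then show ?thesis by simp
  qed
  finally have "?u < \<infinity>" by (auto simp: ennreal_mult_less_top less_top)
  then show ?thesis by (simp add: integrable_iff_bounded)
qed

theorem corollary3p2:
  fixes \<alpha> :: real
  assumes "\<alpha> > real DIM('a::euclidean_space) / 2"
  shows "\<exists>C::real. \<forall>(U::'a \<Rightarrow> real) (W::'a \<Rightarrow> real).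
           U \<in> borel_measurable lebesgue \<longrightarrow>
           W \<in> L_infty \<longrightarrow>
           (AE x in lebesgue. W (- x) = W x) \<longrightarrow>
           (\<exists>\<beta>\<^sub>0>0. \<forall>\<beta>. 0 < \<beta> \<and> \<beta> < \<beta>\<^sub>0 \<and>
               (\<forall>N\<ge>2. integrable (lebesgue_conf N) (\<lambda>x. exp (- \<beta> * energy U W N x))) \<longrightarrow>
             (\<exists>\<rho>. is_minimizer \<beta> U W \<rho>) \<and>
             (\<exists>N\<^sub>0::nat. \<forall>N>N\<^sub>0. \<forall>\<rho>. is_minimizer \<beta> U W \<rho> \<longrightarrow>
                (\<integral>\<^sup>+X. Hneg_norm2_diff \<alpha> (empirical N X) (density lebesgue (\<lambda>x. ennreal (\<rho> x)))
                   \<partial>gibbs \<beta> U W N) \<le> ennreal (C / real N)))"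
proof -
  define w where "w = (\<integral>\<^sup>+\<xi>. ennreal ((1 + (norm \<xi>)\<^sup>2) powr (- \<alpha>)) \<partial>(lborel :: 'a measure))"
  have w: "w = ennreal (enn2real w)"
    using nn_integral_powr_weight[OF assms] by (simp add: w_def)
  have bound: "ennreal (24 / N) * w = ennreal (24 * enn2real w / N)" for N :: nat
    by (subst w, subst ennreal_mult[symmetric]) auto
  show ?thesis
  \<comment> \<open>The constant is 24 times the integral of the Sobolev weight, so it depends on
    \<alpha> and the dimension only.\<close>
  proof (rule exI[of _ "24 * enn2real w"], intro allI impI)
    fix U W :: "'a \<Rightarrow> real"
    assume U: "U \<in> borel_measurable lebesgue" and W: "W \<in> L_infty" and sym: "AE x in lebesgue. W (- x) = W x"
    obtain U' where U'[measurable]: "U' \<in> borel_measurable borel" and UU': "AE x in lborel. U x = U' x"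
      using borel_version[OF U] .
    obtain W' B where W'[measurable]: "W' \<in> borel_measurable borel" and WW': "AE x in lborel. W x = W' x"
      and W'_sym: "\<And>x. W' (- x) = W' x" and B: "0 < B" and W'_bound: "\<And>x. \<bar>W' x\<bar> \<le> B"
      by (rule bounded_symmetric_borel_version[OF W sym]) (rule that)
    show "\<exists>\<beta>\<^sub>0>0. \<forall>\<beta>. 0 < \<beta> \<and> \<beta> < \<beta>\<^sub>0 \<and>
               (\<forall>N\<ge>2. integrable (lebesgue_conf N) (\<lambda>x. exp (- \<beta> * energy U W N x))) \<longrightarrow>
             (\<exists>\<rho>. is_minimizer \<beta> U W \<rho>) \<and>
             (\<exists>N\<^sub>0::nat. \<forall>N>N\<^sub>0. \<forall>\<rho>. is_minimizer \<beta> U W \<rho> \<longrightarrow>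
                (\<integral>\<^sup>+X. Hneg_norm2_diff \<alpha> (empirical N X) (density lebesgue (\<lambda>x. ennreal (\<rho> x)))
                   \<partial>gibbs \<beta> U W N) \<le> ennreal (24 * enn2real w / real N))"
    \<comment> \<open>The threshold depends on \<open>W\<close> through its essential bound
      \<open>B\<close>.\<close>
    proof (intro exI[of _ "1 / (64 * B)"] conjI allI impI; (elim conjE)?)
      show "0 < 1 / (64 * B)" using B by simp
      fix \<beta> :: real
      assume \<beta>: "0 < \<beta>" "\<beta> < 1 / (64 * B)"
        and int: "\<forall>N\<ge>2. integrable (lebesgue_conf N) (\<lambda>x. exp (- \<beta> * energy U W N x))"
      \<comment> \<open>The two-particle case yields integrability of
        \<open>exp (- \<beta> * U')\<close>.\<close>
      have int2: "integrable (lebesgue_conf 2) (\<lambda>x. exp (- \<beta> * energy U W 2 x))" using int by simp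
      have ae: "AE x in (\<Pi>\<^sub>M i\<in>{1..2::nat}. lborel). exp (- \<beta> * energy U W 2 x) = exp (- \<beta> * energy U' W' 2 x)"
        using AE_energy_eq[OF UU' WW', of 2] by eventually_elim simp
      have meas: "(\<lambda>x. exp (- \<beta> * energy U' W' 2 x)) \<in> borel_measurable (\<Pi>\<^sub>M i\<in>{1..2::nat}. lborel)"
        unfolding energy_def by measurable
      have "integrable (\<Pi>\<^sub>M i\<in>{1..2::nat}. lborel) (\<lambda>x. exp (- \<beta> * energy U' W' 2 x))"
        using int2 unfolding lebesgue_conf_def integral_completion_AE(2)[OF ae meas] .
      then have expU: "integrable lborel (\<lambda>x. exp (- \<beta> * U' x))"
        by (rule integrable_exp_potential[OF U' W' W'_bound \<beta>(1)])
      interpret mean_field U' W' B \<beta>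
      proof
        show "64 * \<beta> * B \<le> 1" using \<beta>(2) B by (simp add: field_simps)
      qed (rule U' W' W'_bound W'_sym B \<beta>(1) expU)+
      obtain \<phi> where sol: "admissible \<phi>" "convolve (gibbs_density \<phi>) = \<phi>" using fixed_point_exists by auto
      show "\<exists>\<rho>. is_minimizer \<beta> U W \<rho>" using fixed_point_is_minimizer[OF UU' WW' sol] by blast
      show "\<exists>N\<^sub>0::nat. \<forall>N>N\<^sub>0. \<forall>\<rho>. is_minimizer \<beta> U W \<rho> \<longrightarrow>
                (\<integral>\<^sup>+X. Hneg_norm2_diff \<alpha> (empirical N X) (density lebesgue (\<lambda>x. ennreal (\<rho> x)))
                   \<partial>gibbs \<beta> U W N) \<le> ennreal (24 * enn2real w / real N)"
      \<comment> \<open>\<open>N > 1\<close> means at least two particles, the range in which the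
        factor \<open>1 / (N - 1)\<close> in the energy makes sense.\<close>
      proof (intro exI[of _ 1] allI impI)
        fix N :: nat and \<rho> assume "1 < N" and \<rho>: "is_minimizer \<beta> U W \<rho>"
        interpret mean_field_gibbs U' W' B \<beta> \<phi> N "{1..N}"
          by unfold_locales (use sol \<open>1 < N\<close> in auto)
        have "\<And>x. 0 \<le> \<rho> x" using \<rho> by (simp add: is_minimizer_def prob_densities_def)
        from expected_Hneg_norm2_le[OF UU' WW' minimizer_AE_eq_fixed_point[OF UU' WW' sol \<rho>] this, of \<alpha>]
        show "(\<integral>\<^sup>+X. Hneg_norm2_diff \<alpha> (empirical N X) (density lebesgue (\<lambda>x. ennreal (\<rho> x)))
                   \<partial>gibbs \<beta> U W N) \<le> ennreal (24 * enn2real w / real N)"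
          unfolding w_def[symmetric] bound .
      qed
    qed
  qed
qed

end
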